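(* The following inclusions hold, and each set is a face of the next one: $$\mathcal{S}^{\mathbb{U}_{\mathbb{Z}}}(\mathfrak{B}_0)\subset_F\mathcal{S}^{\mathbb{O}_{\mathbb{Z}}}(\mathfrak{B}_0)\subset_F\mathcal{S}^{\mathbb{P}_{\mathbb{Z}}}(\mathfrak{B}_0)\subset_F\mathcal{S}^{\mathbb{Z}}(\mathfrak{B}_0).$$
   Context: $\mathcal{H}$ is an infinite-dimensional separable complex Hilbert space (inner product linear in the first variable) with a fixed orthonormal basis $\{e_k:k\in\mathbb{Z}\}$, and $\sigma(x,y)=\mathrm{Im}\langle x,y\rangle$. $\mathrm{CCR}(\mathcal{H},\sigma)$ is the universal $C^*$-algebra generated by elements $W(x)$, $x\in\mathcal{H}$, with $W(x)^*=W(-x)$ and $W(x)W(y)=e^{i\sigma(x,y)}W(x+y)$. $\mathcal{H}_0$ is the (algebraic) linear span of $\{e_k\}$, and $\mathfrak{B}_0$ is the $C^*$-subalgebra generated by $\{W(x):x\in\mathcal{H}_0\}$. Any isometry $S$ of $\mathcal{H}$ induces a $*$-monomorphism $\rho_S(W(x))=W(Sx)$; the following ones restrict to automorphisms of $\mathfrak{B}_0$. $\mathbb{U}_{\mathbb{Z}}$ is the group of unitaries $U$ on $\mathcal{H}$ for which there is $N>0$ with $Ue_i=e_i$ for all $|i|>N$. $\mathbb{O}_{\mathbb{Z}}$ is the subgroup of those $O\in\mathbb{U}_{\mathbb{Z}}$ with $\langle Oe_i,e_j\rangle\in\mathbb{R}$ for all $i,j$. $\mathbb{P}_{\mathbb{Z}}$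 is the group of bijections $s$ of $\mathbb{Z}$ with $s(i)\ne i$ for only finitely many $i$, acting via the unitaries $e_i\mapsto e_{s(i)}$. The shift automorphism is the one induced by $e_i\mapsto e_{i+1}$, $i\in\mathbb{Z}$. For $G=\mathbb{U}_{\mathbb{Z}},\mathbb{O}_{\mathbb{Z}},\mathbb{P}_{\mathbb{Z}}$, $\mathcal{S}^G(\mathfrak{B}_0)$ is the set of states on $\mathfrak{B}_0$ invariant under all the automorphisms induced by $G$; $\mathcal{S}^{\mathbb{Z}}(\mathfrak{B}_0)$ is the set of states invariant under the shift automorphism. A convex subset $\Delta$ of a convex set $C$ is a face, written $\Delta\subset_F C$, if whenever $x,y\in C$ and $tx+(1-t)y\in\Delta$ for some $0<t<1$, then $x,y\in\Delta$. *)

theory Defs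
  imports "HOL-Analysis.Analysis" "HOL-Library.Function_Algebras"
begin

section \<open>Complex Hilbert spaces\<close>

class complex_vector = real_vector +
  fixes scaleC :: "complex \<Rightarrow> 'a \<Rightarrow> 'a"  (infixr \<open>*\<^sub>C\<close> 75)
  assumes scaleC_add_right: "c *\<^sub>C (x + y) = c *\<^sub>C x + c *\<^sub>C y"
    and scaleC_add_left: "(c + d) *\<^sub>C x = c *\<^sub>C x + d *\<^sub>C x"
    and scaleC_scaleC: "c *\<^sub>C d *\<^sub>C x = (c * d) *\<^sub>C x"
    and scaleC_of_real: "complex_of_real r *\<^sub>C x = r *\<^sub>R x"

lemma scaleC_one [simp]: "1 *\<^sub>C (x :: 'a :: complex_vector) = x"
  using scaleC_of_real [of 1 x] by simp

global_interpretation complex_vector: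
  vector_space "scaleC :: complex \<Rightarrow> 'a \<Rightarrow> 'a :: complex_vector"
  defines cspan = complex_vector.span
  by unfold_locales (simp_all add: scaleC_add_right scaleC_add_left scaleC_scaleC)

abbreviation clinear :: "('a::complex_vector \<Rightarrow> 'b::complex_vector) \<Rightarrow> bool"
  where "clinear \<equiv> Vector_Spaces.linear scaleC scaleC"

class complex_hilbert = complex_vector + banach +
  fixes cinner :: "'a \<Rightarrow> 'a \<Rightarrow> complex"
  assumes cinner_commute: "cinner x y = cnj (cinner y x)"
    and cinner_add_left: "cinner (x + y) z = cinner x z + cinner y z"
    and cinner_scaleC_left: "cinner (c *\<^sub>C x) y = c * cinner x y"
    and cinner_self: "cinner x x = complex_of_real ((norm x)\<^sup>2)"

text \<open>The index set \<open>\<int>\<close> makes the space infinite-dimensional and separable.\<close>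

definition orthonormal_basis :: "(int \<Rightarrow> 'h::complex_hilbert) \<Rightarrow> bool" where
  "orthonormal_basis e \<longleftrightarrow>
     (\<forall>i j. cinner (e i) (e j) = (if i = j then 1 else 0)) \<and> closure (cspan (range e)) = UNIV"

definition unitary :: "('h::complex_hilbert \<Rightarrow> 'h) \<Rightarrow> bool" where
  "unitary U \<longleftrightarrow> clinear U \<and> surj U \<and> (\<forall>x y. cinner (U x) (U y) = cinner x y)"

definition symp :: "'h::complex_hilbert \<Rightarrow> 'h \<Rightarrow> real" where
  "symp x y = Im (cinner x y)"


section \<open>C*-algebras\<close>

text \<open>
  C*-algebras are not assumed to be unital and homomorphisms are not assumed to preserve units.
  They come in two forms: as a type class, for the algebra under study, and as structures on a
  subset of a type, because the universal property below quantifies over all C*-algebras.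
\<close>

class cstar_algebra = complex_vector + real_normed_algebra + banach +
  fixes star :: "'a \<Rightarrow> 'a"
  assumes mult_scaleC_left: "(c *\<^sub>C a) * b = c *\<^sub>C (a * b)"
    and mult_scaleC_right: "a * (c *\<^sub>C b) = c *\<^sub>C (a * b)"
    and norm_scaleC: "norm (c *\<^sub>C a) = cmod c * norm a"
    and star_star: "star (star a) = a"
    and star_add: "star (a + b) = star a + star b"
    and star_scaleC: "star (c *\<^sub>C a) = cnj c *\<^sub>C star a"
    and star_mult: "star (a * b) = star b * star a"
    and cstar_identity: "norm (star a * a) = (norm a)\<^sup>2"

record 'b cstar_struct =
  cs_carrier :: "'b set"
  cs_zero :: "'b"  (\<open>\<zero>\<index>\<close>)
  cs_add :: "'b \<Rightarrow> 'b \<Rightarrow> 'b"  (infixl \<open>\<oplus>\<index>\<close> 65)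
  cs_scale :: "complex \<Rightarrow> 'b \<Rightarrow> 'b"  (infixr \<open>\<odot>\<index>\<close> 75)
  cs_mult :: "'b \<Rightarrow> 'b \<Rightarrow> 'b"  (infixl \<open>\<otimes>\<index>\<close> 70)
  cs_star :: "'b \<Rightarrow> 'b"
  cs_norm :: "'b \<Rightarrow> real"

locale cstar_algebra_on =
  fixes B :: "'b cstar_struct" (structure)
  assumes zero_closed: "\<zero> \<in> cs_carrier B"
    and add_closed: "\<lbrakk>a \<in> cs_carrier B; b \<in> cs_carrier B\<rbrakk> \<Longrightarrow> a \<oplus> b \<in> cs_carrier B"
    and scale_closed: "a \<in> cs_carrier B \<Longrightarrow> z \<odot> a \<in> cs_carrier B"
    and mult_closed: "\<lbrakk>a \<in> cs_carrier B; b \<in> cs_carrier B\<rbrakk> \<Longrightarrow> a \<otimes> b \<in> cs_carrier B"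
    and star_closed: "a \<in> cs_carrier B \<Longrightarrow> cs_star B a \<in> cs_carrier B"
    and add_assoc: "\<lbrakk>a \<in> cs_carrier B; b \<in> cs_carrier B; c \<in> cs_carrier B\<rbrakk>
          \<Longrightarrow> a \<oplus> b \<oplus> c = a \<oplus> (b \<oplus> c)"
    and add_commute: "\<lbrakk>a \<in> cs_carrier B; b \<in> cs_carrier B\<rbrakk> \<Longrightarrow> a \<oplus> b = b \<oplus> a"
    and add_zero: "a \<in> cs_carrier B \<Longrightarrow> \<zero> \<oplus> a = a"
    and add_inverse: "a \<in> cs_carrier B \<Longrightarrow> a \<oplus> (-1) \<odot> a = \<zero>"
    and scale_one: "a \<in> cs_carrier B \<Longrightarrow> 1 \<odot> a = a"
    and scale_scale: "a \<in> cs_carrier B \<Longrightarrow> z \<odot> w \<odot> a = (z * w) \<odot> a"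
    and scale_add_left: "a \<in> cs_carrier B \<Longrightarrow> (z + w) \<odot> a = z \<odot> a \<oplus> w \<odot> a"
    and scale_add_right: "\<lbrakk>a \<in> cs_carrier B; b \<in> cs_carrier B\<rbrakk>
          \<Longrightarrow> z \<odot> (a \<oplus> b) = z \<odot> a \<oplus> z \<odot> b"
    and mult_assoc: "\<lbrakk>a \<in> cs_carrier B; b \<in> cs_carrier B; c \<in> cs_carrier B\<rbrakk>
          \<Longrightarrow> a \<otimes> b \<otimes> c = a \<otimes> (b \<otimes> c)"
    and mult_add_left: "\<lbrakk>a \<in> cs_carrier B; b \<in> cs_carrier B; c \<in> cs_carrier B\<rbrakk>
          \<Longrightarrow> (a \<oplus> b) \<otimes> c = a \<otimes> c \<oplus> b \<otimes> c"
    and mult_add_right: "\<lbrakk>a \<in> cs_carrier B; b \<in> cs_carrier B; c \<in> cs_carrier B\<rbrakk>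
          \<Longrightarrow> a \<otimes> (b \<oplus> c) = a \<otimes> b \<oplus> a \<otimes> c"
    and mult_scale_left: "\<lbrakk>a \<in> cs_carrier B; b \<in> cs_carrier B\<rbrakk>
          \<Longrightarrow> (z \<odot> a) \<otimes> b = z \<odot> (a \<otimes> b)"
    and mult_scale_right: "\<lbrakk>a \<in> cs_carrier B; b \<in> cs_carrier B\<rbrakk>
          \<Longrightarrow> a \<otimes> (z \<odot> b) = z \<odot> (a \<otimes> b)"
    and star_star: "a \<in> cs_carrier B \<Longrightarrow> cs_star B (cs_star B a) = a"
    and star_add: "\<lbrakk>a \<in> cs_carrier B; b \<in> cs_carrier B\<rbrakk>
          \<Longrightarrow> cs_star B (a \<oplus> b) = cs_star B a \<oplus> cs_star B b"
    and star_scale: "a \<in> cs_carrier B \<Longrightarrow> cs_star B (z \<odot> a) = cnj z \<odot> cs_star B a"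
    and star_mult: "\<lbrakk>a \<in> cs_carrier B; b \<in> cs_carrier B\<rbrakk>
          \<Longrightarrow> cs_star B (a \<otimes> b) = cs_star B b \<otimes> cs_star B a"
    and norm_nonneg: "a \<in> cs_carrier B \<Longrightarrow> 0 \<le> cs_norm B a"
    and norm_eq_zero: "a \<in> cs_carrier B \<Longrightarrow> cs_norm B a = 0 \<longleftrightarrow> a = \<zero>"
    and norm_add: "\<lbrakk>a \<in> cs_carrier B; b \<in> cs_carrier B\<rbrakk>
          \<Longrightarrow> cs_norm B (a \<oplus> b) \<le> cs_norm B a + cs_norm B b"
    and norm_scale: "a \<in> cs_carrier B \<Longrightarrow> cs_norm B (z \<odot> a) = cmod z * cs_norm B a"
    and norm_mult: "\<lbrakk>a \<in> cs_carrier B; b \<in> cs_carrier B\<rbrakk>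
          \<Longrightarrow> cs_norm B (a \<otimes> b) \<le> cs_norm B a * cs_norm B b"
    and cstar_identity: "a \<in> cs_carrier B \<Longrightarrow> cs_norm B (cs_star B a \<otimes> a) = (cs_norm B a)\<^sup>2"
    and complete: "Metric_space.mcomplete (cs_carrier B) (\<lambda>a b. cs_norm B (a \<oplus> (-1) \<odot> b))"

definition type_cstar :: "'a::cstar_algebra cstar_struct" where
  "type_cstar = \<lparr>cs_carrier = UNIV, cs_zero = 0, cs_add = (+), cs_scale = scaleC,
     cs_mult = (*), cs_star = star, cs_norm = norm\<rparr>"

lemma type_cstar_simps [simp]:
  "cs_carrier (type_cstar :: 'a::cstar_algebra cstar_struct) = UNIV"
  "cs_zero (type_cstar :: 'a cstar_struct) = 0"
  "cs_add (type_cstar :: 'a cstar_struct) = (+)"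
  "cs_scale (type_cstar :: 'a cstar_struct) = scaleC"
  "cs_mult (type_cstar :: 'a cstar_struct) = (*)"
  "cs_star (type_cstar :: 'a cstar_struct) = star"
  "cs_norm (type_cstar :: 'a cstar_struct) = norm"
  by (simp_all add: type_cstar_def)

lemma cstar_algebra_on_type_cstar: "cstar_algebra_on (type_cstar :: 'a::cstar_algebra cstar_struct)"
proof -
  have minus: "(-1) *\<^sub>C b = - b" for b :: 'a
    using scaleC_of_real [of "-1" b] by simp
  have "complete (UNIV :: 'a set)"
    by (rule complete_UNIV)
  then have "Metric_space.mcomplete (UNIV :: 'a set) dist"
    by (simp add: mcomplete_iff_complete)
  then have "Metric_space.mcomplete (UNIV :: 'a set) (\<lambda>a b. norm (a - b))"
    unfolding dist_norm [abs_def] .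
  then show ?thesis
    by unfold_locales
      (simp_all add: minus scaleC_add_left scaleC_add_right scaleC_scaleC algebra_simps
        mult_scaleC_left mult_scaleC_right norm_scaleC Defs.star_star Defs.star_add
        star_scaleC Defs.star_mult Defs.cstar_identity norm_triangle_ineq norm_mult_ineq)
qed

definition star_hom :: "'a cstar_struct \<Rightarrow> 'b cstar_struct \<Rightarrow> ('a \<Rightarrow> 'b) \<Rightarrow> bool" where
  "star_hom A B \<phi> \<longleftrightarrow>
     (\<forall>a\<in>cs_carrier A. \<phi> a \<in> cs_carrier B \<and> \<phi> (cs_star A a) = cs_star B (\<phi> a)) \<and>
     (\<forall>z. \<forall>a\<in>cs_carrier A. \<phi> (cs_scale A z a) = cs_scale B z (\<phi> a)) \<and>
     (\<forall>a\<in>cs_carrier A. \<forall>b\<in>cs_carrier A.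
        \<phi> (cs_add A a b) = cs_add B (\<phi> a) (\<phi> b) \<and> \<phi> (cs_mult A a b) = cs_mult B (\<phi> a) (\<phi> b))"

definition cstar_subalgebra :: "'a::cstar_algebra set \<Rightarrow> bool" where
  "cstar_subalgebra B \<longleftrightarrow> closed B \<and> 0 \<in> B \<and>
     (\<forall>a\<in>B. star a \<in> B \<and> (\<forall>c. c *\<^sub>C a \<in> B)) \<and>
     (\<forall>a\<in>B. \<forall>b\<in>B. a + b \<in> B \<and> a * b \<in> B)"

definition cstar_generated :: "'a::cstar_algebra set \<Rightarrow> 'a set" where
  "cstar_generated X = \<Inter>{B. cstar_subalgebra B \<and> X \<subseteq> B}"

text \<open>
  A state on a C*-subalgebra \<open>B\<close> is a positive linear functional on \<open>B\<close> of norm one.  It is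
  represented by its extension by \<open>0\<close> to the whole type, so that distinct functions are distinct
  states and convex combinations are taken pointwise.
\<close>

definition state_on :: "'a::cstar_algebra set \<Rightarrow> ('a \<Rightarrow> complex) \<Rightarrow> bool" where
  "state_on B \<omega> \<longleftrightarrow>
     (\<forall>a\<in>B. \<forall>b\<in>B. \<omega> (a + b) = \<omega> a + \<omega> b) \<and>
     (\<forall>c. \<forall>a\<in>B. \<omega> (c *\<^sub>C a) = c * \<omega> a) \<and>
     (\<forall>a\<in>B. \<omega> (star a * a) \<in> \<real>\<^sub>\<ge>\<^sub>0) \<and>
     bdd_above ((\<lambda>a. cmod (\<omega> a)) ` {a\<in>B. norm a \<le> 1}) \<and>
     (SUP a\<in>{a\<in>B. norm a \<le> 1}. cmod (\<omega> a)) = 1 \<and>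
     (\<forall>a. a \<notin> B \<longrightarrow> \<omega> a = 0)"


section \<open>The CCR algebra\<close>

definition weyl_relations :: "'b cstar_struct \<Rightarrow> ('h::complex_hilbert \<Rightarrow> 'b) \<Rightarrow> bool" where
  "weyl_relations B V \<longleftrightarrow>
     (\<forall>x. V x \<in> cs_carrier B) \<and>
     (\<forall>x. cs_star B (V x) = V (- x)) \<and>
     (\<forall>x y. cs_mult B (V x) (V y) = cs_scale B (exp (\<i> * complex_of_real (symp x y))) (V (x + y)))"

text \<open>
  The universal C*-algebra generated by elements \<open>W x\<close> subject to the Weyl relations.  HOL cannot
  quantify over the type carrying the target \<open>B\<close>.  The type \<open>'a \<times> complex\<close> is large enough:  only the
  C*-subalgebra of \<open>B\<close> generated by the \<open>V x\<close> matters, for a separable \<open>'h\<close> it has at most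
  continuum many elements, hence it has a copy carried by a subset of \<open>'a \<times> complex\<close>.
\<close>

definition ccr_algebra :: "('h::complex_hilbert \<Rightarrow> 'a::cstar_algebra) \<Rightarrow> bool" where
  "ccr_algebra W \<longleftrightarrow>
     weyl_relations type_cstar W \<and>
     cstar_generated (range W) = UNIV \<and>
     (\<forall>(B :: ('a \<times> complex) cstar_struct) V.
        cstar_algebra_on B \<and> weyl_relations B V \<longrightarrow>
          (\<exists>!\<phi>. star_hom type_cstar B \<phi> \<and> (\<forall>x. \<phi> (W x) = V x)))"

definition weyl_hom :: "('h::complex_hilbert \<Rightarrow> 'a::cstar_algebra) \<Rightarrow> ('h \<Rightarrow> 'h) \<Rightarrow> 'a \<Rightarrow> 'a" where
  "weyl_hom W S = (THE \<rho>. star_hom type_cstar type_cstar \<rho> \<and> (\<forall>x. \<rho> (W x) = W (S x)))"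

definition local_algebra ::
  "(int \<Rightarrow> 'h::complex_hilbert) \<Rightarrow> ('h \<Rightarrow> 'a::cstar_algebra) \<Rightarrow> 'a set" where
  "local_algebra e W = cstar_generated (W ` cspan (range e))"


section \<open>Groups of unitaries and their invariant states\<close>

definition U_Z :: "(int \<Rightarrow> 'h::complex_hilbert) \<Rightarrow> ('h \<Rightarrow> 'h) set" where
  "U_Z e = {U. unitary U \<and> (\<exists>N>0. \<forall>i. \<bar>i\<bar> > N \<longrightarrow> U (e i) = e i)}"

definition O_Z :: "(int \<Rightarrow> 'h::complex_hilbert) \<Rightarrow> ('h \<Rightarrow> 'h) set" where
  "O_Z e = {U \<in> U_Z e. \<forall>i j. cinner (U (e i)) (e j) \<in> \<real>}"

definition basis_unitary :: "(int \<Rightarrow> 'h::complex_hilbert) \<Rightarrow> (int \<Rightarrow> int) \<Rightarrow> 'h \<Rightarrow> 'h" where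
  "basis_unitary e s = (THE U. unitary U \<and> (\<forall>i. U (e i) = e (s i)))"

definition P_Z :: "(int \<Rightarrow> 'h::complex_hilbert) \<Rightarrow> ('h \<Rightarrow> 'h) set" where
  "P_Z e = basis_unitary e ` {s. bij s \<and> finite {i. s i \<noteq> i}}"

definition shift :: "(int \<Rightarrow> 'h::complex_hilbert) \<Rightarrow> 'h \<Rightarrow> 'h" where
  "shift e = basis_unitary e (\<lambda>i. i + 1)"

definition invariant_states ::
  "(int \<Rightarrow> 'h::complex_hilbert) \<Rightarrow> ('h \<Rightarrow> 'a::cstar_algebra) \<Rightarrow> ('h \<Rightarrow> 'h) set \<Rightarrow> ('a \<Rightarrow> complex) set"
  where
  "invariant_states e W G =
     {\<omega>. state_on (local_algebra e W) \<omega> \<and>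
         (\<forall>U\<in>G. \<forall>a\<in>local_algebra e W. \<omega> (weyl_hom W U a) = \<omega> a)}"


section \<open>Faces\<close>

instantiation "fun" :: (type, real_vector) real_vector
begin

definition "scaleR_fun r f = (\<lambda>x. r *\<^sub>R f x)"

instance
  by standard (auto simp: scaleR_fun_def plus_fun_def scaleR_add_left scaleR_add_right)

end

definition is_face :: "'v::real_vector set \<Rightarrow> 'v set \<Rightarrow> bool"  (infix \<open>\<subset>\<^sub>F\<close> 50) where
  "\<Delta> \<subset>\<^sub>F C \<longleftrightarrow> convex C \<and> \<Delta> face_of C"

lemma is_face_iff:
  "\<Delta> \<subset>\<^sub>F C \<longleftrightarrow> convex C \<and> convex \<Delta> \<and> \<Delta> \<subseteq> C \<and>
     (\<forall>x\<in>C. \<forall>y\<in>C. \<forall>t::real. 0 < t \<and> t < 1 \<and> t *\<^sub>R x + (1 - t) *\<^sub>R y \<in> \<Delta> \<longrightarrow> x \<in> \<Delta> \<and> y \<in> \<Delta>)"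
  (is "_ \<longleftrightarrow> _ \<and> _ \<and> _ \<and> ?R")
proof -
  have "(\<forall>a\<in>C. \<forall>b\<in>C. \<forall>x\<in>\<Delta>. x \<in> open_segment a b \<longrightarrow> a \<in> \<Delta> \<and> b \<in> \<Delta>) \<longleftrightarrow> ?R" (is "?L \<longleftrightarrow> _")
  proof
    assume L: ?L
    show ?R
    proof (intro ballI allI impI)
      fix x y and t :: real
      assume xy: "x \<in> C" "y \<in> C"
        and t: "0 < t \<and> t < 1 \<and> t *\<^sub>R x + (1 - t) *\<^sub>R y \<in> \<Delta>"
      show "x \<in> \<Delta> \<and> y \<in> \<Delta>"
      proof (cases "x = y")
        case True
        with t show ?thesis by (simp flip: scaleR_add_left)
      next
        case False
        then have "t *\<^sub>R x + (1 - t) *\<^sub>R y \<in> open_segment y x"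
          using t by (auto simp: in_segment add.commute)
        with L xy t show ?thesis by blast
      qed
    qed
  next
    assume R: ?R
    show ?L
    proof (intro ballI impI)
      fix a b x
      assume ab: "a \<in> C" "b \<in> C" and x: "x \<in> \<Delta>" "x \<in> open_segment a b"
      then obtain u where "0 < u" "u < 1" "x = (1 - u) *\<^sub>R a + u *\<^sub>R b"
        by (auto simp: in_segment)
      with R ab x(1) show "a \<in> \<Delta> \<and> b \<in> \<Delta>"
        by (metis add.commute)
    qed
  qed
  then show ?thesis
    by (auto simp: is_face_def face_of_def)
qed

end

theory Submission
  imports Defs
begin

text \<open>
  Let \<open>G\<close> be one of the three groups and let \<open>\<phi>\<close> be a shift-invariant state with \<open>t\<phi> \<le> \<omega>\<close> for some
  \<open>G\<close>-invariant \<open>\<omega>\<close>.  Given \<open>U \<in> G\<close> and \<open>x\<close> in \<open>\<H>\<^sub>0\<close>, both supported on a window of sites, put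
  \<open>b = W(Ux) - W(x)\<close> and let \<open>c\<close> be the sum of \<open>k\<close> translates of \<open>b\<close> to pairwise disjoint windows.
  Conjugating \<open>U\<close> into one of these windows shows that \<open>\<omega>(b\<^sub>n\<^sup>* b\<^sub>m) = 0\<close> for \<open>n \<noteq> m\<close>, so
  \<open>k\<^sup>2 \<bar>\<phi>(b)\<bar>\<^sup>2 = \<bar>\<phi>(c)\<bar>\<^sup>2 \<le> \<phi>(c\<^sup>* c) \<le> \<omega>(c\<^sup>* c)/t \<le> 4k/t\<close>, and \<open>\<phi>(b) = 0\<close>.  Hence all three sets are faces of the
  shift-invariant states.  Passing from Weyl elements to the whole local algebra uses that
  star-homomorphisms are contractive.
\<close>

section \<open>Unitaries permuting an orthonormal basis\<close>

interpretation clinear_pair: vector_space_pair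
  "scaleC :: complex \<Rightarrow> 'a \<Rightarrow> 'a :: complex_vector" "scaleC :: complex \<Rightarrow> 'b \<Rightarrow> 'b :: complex_vector"
  by unfold_locales

lemma clinearI:
  assumes "\<And>x y. f (x + y) = f x + f y" "\<And>c x. f (c *\<^sub>C x) = c *\<^sub>C f x"
  shows "clinear f"
  using assms by unfold_locales auto

lemma clinear_add: "clinear f \<Longrightarrow> f (x + y) = f x + f y"
  by (rule clinear_pair.linear_add)

lemma clinear_scaleC: "clinear f \<Longrightarrow> f (c *\<^sub>C x) = c *\<^sub>C f x"
  by (rule clinear_pair.linear_scale)

lemma clinear_diff: "clinear f \<Longrightarrow> f (x - y) = f x - f y"
  by (rule clinear_pair.linear_diff)

lemma clinear_uminus: "clinear f \<Longrightarrow> f (- x) = - f x"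
  by (rule clinear_pair.linear_neg)

lemma clinear_comp: "clinear f \<Longrightarrow> clinear g \<Longrightarrow> clinear (\<lambda>x. g (f x))"
  by (intro clinearI) (simp_all add: clinear_add clinear_scaleC)

lemma clinear_cspan_mono:
  assumes "clinear f" "x \<in> cspan S" "f ` S \<subseteq> cspan T"
  shows "f x \<in> cspan T"
  using assms(2)
proof (induction rule: complex_vector.span_induct_alt)
  case base
  then show ?case using clinear_pair.linear_0[OF assms(1)] complex_vector.span_zero by simp
next
  case (step c x y)
  then show ?case
    using assms by (auto simp: clinear_add clinear_scaleC intro!: complex_vector.span_add complex_vector.span_scale)
qed

lemma clinear_eq_on_cspan:
  "clinear f \<Longrightarrow> clinear g \<Longrightarrow> (\<And>x. x \<in> S \<Longrightarrow> f x = g x) \<Longrightarrow> x \<in> cspan S \<Longrightarrow> f x = g x"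
  by (rule clinear_pair.linear_eq_on)

lemma scaleC_minus_one: "(- 1) *\<^sub>C x = - (x :: 'a :: complex_vector)"
  using complex_vector.scale_minus_left[of 1 x] by simp

lemma cinner_add_right: "cinner x (y + z) = cinner x y + cinner x z"
  by (metis cinner_add_left cinner_commute complex_cnj_add)

lemma cinner_scaleC_right: "cinner x (c *\<^sub>C y) = cnj c * cinner x y"
  by (metis cinner_scaleC_left cinner_commute complex_cnj_mult)

lemma cinner_minus_left: "cinner (- x) z = - cinner x z"
  using cinner_scaleC_left[of "- 1" x z] by (simp add: scaleC_minus_one)

lemma cinner_diff_left: "cinner (x - y) z = cinner x z - cinner y z"
  by (metis cinner_add_left diff_add_cancel eq_diff_eq)

lemma cinner_zero_left [simp]: "cinner 0 z = 0"
  using cinner_diff_left[of z z z] by simp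

lemma cinner_zero_right [simp]: "cinner z 0 = 0"
  using cinner_commute[of z 0] by simp

lemma cinner_sum_left: "cinner (sum f A) z = (\<Sum>i\<in>A. cinner (f i) z)"
  by (induction A rule: infinite_finite_induct) (simp_all add: cinner_add_left)

lemma norm_cinner: "(norm x)\<^sup>2 = Re (cinner x x)"
  by (simp add: cinner_self)

lemma cinner_diff_right: "cinner x (y - z) = cinner x y - cinner x z"
  by (metis cinner_add_right diff_add_cancel eq_diff_eq)

text \<open>With the inner product written in terms of norms, its joint continuity follows from the
  continuity of the norm and of the vector operations; see
  \<open>continuous_on_cinner\<close>.\<close>

lemma cinner_polarization:
  "cinner x y = complex_of_real (((norm (x + y))\<^sup>2 - (norm (x - y))\<^sup>2) / 4)
     + \<i> * complex_of_real (((norm (x + \<i> *\<^sub>C y))\<^sup>2 - (norm (x - \<i> *\<^sub>C y))\<^sup>2) / 4)"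
proof -
  \<comment> \<open>Used with \<open>v = y\<close> and \<open>v = \<i> *\<^sub>C y\<close>. The two
    instances give the sum and, after multiplication by \<open>\<i>\<close>, the difference of
    \<open>cinner x y\<close> and \<open>cinner y x\<close>.\<close>
  have eq: "complex_of_real ((norm (u + v))\<^sup>2 - (norm (u - v))\<^sup>2) = 2 * (cinner u v + cinner v u)" for u v :: 'a
    unfolding of_real_diff cinner_self[symmetric] cinner_add_left cinner_add_right cinner_diff_left cinner_diff_right
    by simp
  show ?thesis
    unfolding of_real_divide eq cinner_scaleC_left cinner_scaleC_right
    by (simp add: algebra_simps add_divide_distrib diff_divide_distrib)
qed

lemma norm_scaleC_hilbert: "norm (c *\<^sub>C x) = cmod c * norm (x :: 'a :: complex_hilbert)"
proof -
  have "complex_of_real ((norm (c *\<^sub>C x))\<^sup>2) = complex_of_real ((cmod c * norm x)\<^sup>2)"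
    unfolding cinner_self[symmetric] cinner_scaleC_left cinner_scaleC_right power_mult_distrib of_real_mult
    using complex_norm_square[of c] by (simp add: mult.commute[of "cnj c"] flip: mult.assoc)
  then show ?thesis
    unfolding of_real_eq_iff by (rule power2_eq_imp_eq) simp_all
qed

section \<open>Continuity, density and unitaries\<close>

lemma continuous_on_scaleC_hilbert [continuous_intros]:
  "continuous_on S f \<Longrightarrow> continuous_on S (\<lambda>x. c *\<^sub>C (f x :: 'a :: complex_hilbert))"
proof -
  have "bounded_linear (\<lambda>x :: 'a. c *\<^sub>C x)"
  proof (rule bounded_linear_intro[where K = "cmod c"])
    fix r and x :: 'a
    show "c *\<^sub>C r *\<^sub>R x = r *\<^sub>R c *\<^sub>C x"
      by (simp flip: scaleC_of_real add: scaleC_scaleC mult.commute)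
  qed (simp_all add: scaleC_add_right norm_scaleC_hilbert mult.commute)
  then show "continuous_on S f \<Longrightarrow> ?thesis"
    by (rule bounded_linear.continuous_on)
qed

lemma continuous_on_cinner [continuous_intros]:
  assumes "continuous_on S f" "continuous_on S g"
  shows "continuous_on S (\<lambda>x. cinner (f x) (g x))"
  unfolding cinner_polarization by (intro continuous_intros assms) auto

lemma continuous_eq_on_closure:
  fixes f g :: "'a::topological_space \<Rightarrow> 'b::t2_space"
  assumes "continuous_on UNIV f" "continuous_on UNIV g" "\<And>x. x \<in> S \<Longrightarrow> f x = g x" "closure S = UNIV"
  shows "f = g"
proof -
  have "closed {x. f x = g x}"
    using assms(1,2) by (rule closed_Collect_eq)
  then have "closure S \<subseteq> {x. f x = g x}"
    using assms(3) by (intro closure_minimal) auto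
  then show ?thesis using assms(4) by auto
qed

lemma isometry_norm:
  "clinear f \<Longrightarrow> (\<And>x y. x \<in> S \<Longrightarrow> y \<in> S \<Longrightarrow> cinner (f x) (f y) = cinner x y) \<Longrightarrow> x \<in> S \<Longrightarrow> norm (f x) = norm x"
  by (rule power2_eq_imp_eq) (simp_all add: norm_cinner)

lemma unitary_continuous:
  assumes "unitary U"
  shows "continuous_on UNIV U"
proof -
  have "norm (U x) = norm x" for x
    using assms by (auto simp: unitary_def intro: isometry_norm[of _ UNIV])
  moreover have "clinear U" using assms by (simp add: unitary_def)
  ultimately have "dist (U x) (U y) = dist x y" for x y
    by (metis clinear_diff dist_norm)
  then show ?thesis
    by (auto simp: continuous_on_iff)
qed

lemma unitary_comp: "unitary U \<Longrightarrow> unitary V \<Longrightarrow> unitary (\<lambda>x. U (V x))"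
  unfolding unitary_def using comp_surj[of V U] by (auto intro: clinear_comp simp: comp_def)

text \<open>An orthonormal family is independent, so the prescribed values extend linearly to its
  span. The extension is isometric because \<open>s\<close> is injective, hence uniformly
  continuous, and so it extends to the closure of the span, where the algebraic identities persist
  by density.\<close>

lemma basis_isometry_exists:
  fixes e :: "int \<Rightarrow> 'h::complex_hilbert"
  assumes e: "orthonormal_basis e" and s: "inj s"
  obtains U where "clinear U" "\<And>x y. cinner (U x) (U y) = cinner x y" "\<And>i. U (e i) = e (s i)"
    "continuous_on UNIV U"
proof -
  let ?S = "cspan (range e)"
  have on: "cinner (e i) (e j) = (if i = j then 1 else 0)" for i j
    using e by (simp add: orthonormal_basis_def)
  have cl: "closure ?S = UNIV"
    using e by (simp add: orthonormal_basis_def)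
  have inj: "inj e"
    by (metis (mono_tags, lifting) injI on zero_neq_one)
  \<comment> \<open>Pairing a vanishing combination with one of its own vectors leaves only the
    coefficient of that vector.\<close>
  have "complex_vector.independent (range e)"
    unfolding complex_vector.independent_explicit_finite_subsets
  proof (intro allI impI ballI)
    fix A u v
    assume A: "A \<subseteq> range e" "finite A" "(\<Sum>v\<in>A. u v *\<^sub>C v) = 0" "v \<in> A"
    then have "cinner w v = (if w = v then 1 else 0)" if "w \<in> A" for w
    proof -
      have "w \<in> range e" "v \<in> range e"
        using A(1,4) that by auto
      then obtain i j where "w = e i" "v = e j"
        by blast
      then show ?thesis
        using inj by (simp add: on inj_eq)
    qed
    then have "cinner (\<Sum>v\<in>A. u v *\<^sub>C v) v = (\<Sum>w\<in>A. u w * (if w = v then 1 else 0))"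
      by (simp add: cinner_sum_left cinner_scaleC_left)
    then show "u v = 0"
      using A by (simp add: if_distrib cong: if_cong)
  qed
  then obtain g where g: "clinear g" "\<And>i. g (e i) = e (s i)"
    using clinear_pair.linear_independent_extend[of "range e" "\<lambda>x. e (s (inv e x))"] inj
    by (auto simp: inv_f_f)
  note lin = clinear_add[OF g(1)] clinear_scaleC[OF g(1)] clinear_pair.linear_0[OF g(1)]
  have basis: "cinner (g x) (g (e j)) = cinner x (e j)" if "x \<in> ?S" for x j
    using that
    by (induction rule: complex_vector.span_induct_alt)
      (auto simp: lin cinner_add_left cinner_scaleC_left g on inj_eq[OF s])
  have iso: "cinner (g x) (g y) = cinner x y" if "x \<in> ?S" "y \<in> ?S" for x y
    using that(2)
  proof (induction rule: complex_vector.span_induct_alt)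
    case base
    show ?case by (simp add: lin)
  next
    case (step c b y)
    then show ?case
      using basis[OF that(1)] by (auto simp: lin cinner_add_right cinner_scaleC_right)
  qed
  have "dist (g x) (g y) = dist x y" if "x \<in> ?S" "y \<in> ?S" for x y
    using isometry_norm[OF g(1), where S = ?S and x = "x - y", OF iso] that
    by (simp add: dist_norm clinear_diff[OF g(1)] complex_vector.span_diff)
  then have "uniformly_continuous_on ?S g"
    by (auto simp: uniformly_continuous_on_def)
  then obtain U where U: "uniformly_continuous_on UNIV U" "\<And>x. x \<in> ?S \<Longrightarrow> g x = U x"
    by (rule uniformly_continuous_on_extension_on_closure[where X = ?S]) (use cl in auto)
  then have cont: "continuous_on UNIV U"
    using uniformly_continuous_imp_continuous by blast
  have cont': "continuous_on UNIV (\<lambda>x. U (h x))" if "continuous_on UNIV h" for h :: "'h \<Rightarrow> 'h"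
    using continuous_on_compose[OF that continuous_on_subset[OF cont]] by (simp add: comp_def)
  note span = complex_vector.span_add complex_vector.span_scale
  \<comment> \<open>Density is applied to one variable at a time: first to \<open>x\<close> with
    \<open>y\<close> in the span, then to \<open>y\<close> with \<open>x\<close> arbitrary. The
    inner product below is treated in the same way.\<close>
  have add1: "(\<lambda>x. U (x + y)) = (\<lambda>x. U x + U y)" if "y \<in> ?S" for y
    using that
    by (intro continuous_eq_on_closure[OF _ _ _ cl] continuous_intros cont') (simp_all add: U(2)[symmetric] lin span iso)
  have "(\<lambda>y. U (x + y)) = (\<lambda>y. U x + U y)" for x
    using fun_cong[OF add1]
    by (intro continuous_eq_on_closure[OF _ _ _ cl] continuous_intros cont') simp_all
  then have "U (x + y) = U x + U y" for x y
    by (rule fun_cong)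
  moreover have "(\<lambda>x. U (c *\<^sub>C x)) = (\<lambda>x. c *\<^sub>C U x)" for c
    by (intro continuous_eq_on_closure[OF _ _ _ cl] continuous_intros cont') (simp_all add: U(2)[symmetric] lin span iso)
  then have "U (c *\<^sub>C x) = c *\<^sub>C U x" for c x
    by (rule fun_cong)
  ultimately have "clinear U"
    by (rule clinearI)
  moreover have in1: "(\<lambda>x. cinner (U x) (U y)) = (\<lambda>x. cinner x y)" if "y \<in> ?S" for y
    using that
    by (intro continuous_eq_on_closure[OF _ _ _ cl] continuous_intros cont') (simp_all add: U(2)[symmetric] lin span iso)
  have "(\<lambda>y. cinner (U x) (U y)) = (\<lambda>y. cinner x y)" for x
    using fun_cong[OF in1]
    by (intro continuous_eq_on_closure[OF _ _ _ cl] continuous_intros cont') simp_all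
  then have "cinner (U x) (U y) = cinner x y" for x y
    by (rule fun_cong)
  moreover have "U (e i) = e (s i)" for i
    using g(2) U(2)[of "e i"] by (simp add: complex_vector.span_base)
  ultimately show ?thesis
    using cont that by blast
qed

lemma continuous_clinear_eqI:
  fixes f g :: "'h::complex_hilbert \<Rightarrow> 'h"
  assumes "orthonormal_basis e" "clinear f" "clinear g" "continuous_on UNIV f" "continuous_on UNIV g"
    "\<And>i. f (e i) = g (e i)"
  shows "f = g"
proof (rule continuous_eq_on_closure[where S = "cspan (range e)"])
  show "closure (cspan (range e)) = UNIV"
    using assms(1) by (simp add: orthonormal_basis_def)
  show "f x = g x" if "x \<in> cspan (range e)" for x
    by (rule clinear_eq_on_cspan[OF assms(2,3) _ that]) (use assms(6) in auto)
qed (fact assms)+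

text \<open>Unitaries are linear and continuous, so their values on the basis determine them; this
  resolves the definite description in \<open>basis_unitary\<close>.\<close>

lemma basis_unitary_eqI:
  assumes "orthonormal_basis e" "unitary V" "\<And>i. V (e i) = e (s i)"
  shows "basis_unitary e s = V"
  unfolding basis_unitary_def
proof (rule the_equality)
  show "U = V" if "unitary U \<and> (\<forall>i. U (e i) = e (s i))" for U
    using that assms
    by (intro continuous_clinear_eqI[OF assms(1)]) (auto simp: unitary_continuous, auto simp: unitary_def)
qed (use assms in auto)

text \<open>What \<open>basis_isometry_exists\<close> leaves open is surjectivity; the isometry
  belonging to \<open>inv s\<close> is a right inverse.\<close>

lemma
  assumes e: "orthonormal_basis e" and s: "bij s"
  shows unitary_basis_unitary: "unitary (basis_unitary e s)"
    and basis_unitary_apply: "basis_unitary e s (e i) = e (s i)"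
proof -
  obtain U where U: "clinear U" "\<And>x y. cinner (U x) (U y) = cinner x y" "\<And>i. U (e i) = e (s i)"
    "continuous_on UNIV U"
    by (rule basis_isometry_exists[OF e bij_is_inj[OF s]]) (rule that)
  obtain V where V: "clinear V" "\<And>i. V (e i) = e (inv s i)" "continuous_on UNIV V"
    by (rule basis_isometry_exists[OF e bij_is_inj[OF bij_imp_bij_inv[OF s]]]) (rule that)
  have "(\<lambda>x. U (V x)) = (\<lambda>x. x)"
  proof (rule continuous_clinear_eqI[OF e])
    show "continuous_on UNIV (\<lambda>x. U (V x))"
      using continuous_on_compose[OF V(3) continuous_on_subset[OF U(4)]] by (simp add: comp_def)
    show "clinear (\<lambda>x :: 'a. x)"
      by (rule clinearI) simp_all
    show "clinear (\<lambda>x. U (V x))"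
      by (rule clinear_comp[OF V(1) U(1)])
    show "U (V (e i)) = e i" for i
      by (simp add: U(3) V(2) surj_f_inv_f bij_is_surj[OF s])
  qed (rule continuous_on_id)
  then have "surj U"
    by (metis surjI)
  then have "unitary U"
    using U(1,2) by (simp add: unitary_def)
  then show "unitary (basis_unitary e s)" "basis_unitary e s (e i) = e (s i)"
    using basis_unitary_eqI[where V = U and s = s, OF e] U(3) by simp_all
qed

lemma basis_unitary_comp:
  assumes e: "orthonormal_basis e" and "bij s" "bij t"
  shows "basis_unitary e s (basis_unitary e t x) = basis_unitary e (s \<circ> t) x"
proof -
  have "basis_unitary e (s \<circ> t) = (\<lambda>x. basis_unitary e s (basis_unitary e t x))"
    using assms by (intro basis_unitary_eqI) (auto simp: unitary_comp unitary_basis_unitary basis_unitary_apply)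
  then show ?thesis by simp
qed

lemma basis_unitary_id: "orthonormal_basis e \<Longrightarrow> basis_unitary e (\<lambda>i. i) x = x"
  by (subst basis_unitary_eqI[where V = "\<lambda>x. x"]) (auto simp: unitary_def intro: clinearI)

section \<open>Coordinates and finite windows of sites\<close>

lemma cinner_basis_ext:
  assumes e: "orthonormal_basis e" and "\<And>i. cinner x (e i) = cinner y (e i)"
  shows "x = y"
proof -
  have "cinner (x - y) z = 0" if "z \<in> cspan (range e)" for z
    using that assms(2)
    by (induction rule: complex_vector.span_induct_alt)
      (auto simp: cinner_diff_left cinner_add_right cinner_scaleC_right)
  then have "(\<lambda>z. cinner (x - y) z) = (\<lambda>z. 0)"
    using e by (intro continuous_eq_on_closure[of _ _ "cspan (range e)"] continuous_intros)
      (auto simp: orthonormal_basis_def)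
  then have "cinner (x - y) (x - y) = 0"
    by (rule fun_cong)
  then show ?thesis
    by (simp add: cinner_self)
qed

text \<open>The lower bound \<open>M\<close> allows one window to contain both the support of
  \<open>x\<close> and the sites moved by a given unitary.\<close>

lemma cspan_window_exists:
  assumes "x \<in> cspan (range e)"
  obtains N :: int where "N \<ge> M" "x \<in> cspan (e ` {-N..N})"
proof -
  have "\<exists>N\<ge>M. x \<in> cspan (e ` {-N..N})"
    using assms
  proof (induction rule: complex_vector.span_induct_alt)
    case base
    then show ?case using complex_vector.span_zero by blast
  next
    case (step c b y)
    then obtain N i where N: "N \<ge> M" "y \<in> cspan (e ` {-N..N})" "b = e i" by auto
    let ?N = "max N \<bar>i\<bar>"
    have "y \<in> cspan (e ` {-?N..?N})"
      by (rule subsetD[OF complex_vector.span_mono[OF image_mono] N(2)]) auto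
    moreover have "b \<in> cspan (e ` {-?N..?N})"
      unfolding N(3) by (intro complex_vector.span_base imageI) auto
    ultimately have "c *\<^sub>C b + y \<in> cspan (e ` {-?N..?N})"
      by (intro complex_vector.span_add complex_vector.span_scale)
    then show ?case
      using N(1) by (intro exI[of _ ?N]) auto
  qed
  then show ?thesis using that by blast
qed

text \<open>For a site \<open>k\<close> outside the window, \<open>U\<close> fixes
  \<open>e k\<close>, so \<open>U (e j)\<close> has the same coefficient at \<open>k\<close> as
  \<open>e j\<close>, namely 0. Hence \<open>U (e j)\<close> is the finite sum of its coordinates
  inside the window.\<close>

lemma local_unitary_window:
  assumes e: "orthonormal_basis e" and U: "unitary U" and fixed: "\<And>i. \<bar>i\<bar> > N \<Longrightarrow> U (e i) = e i"
    and x: "x \<in> cspan (e ` {-N..N})"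
  shows "U x \<in> cspan (e ` {-N..N})"
proof (rule clinear_cspan_mono[OF _ x])
  show "clinear U"
    using U by (simp add: unitary_def)
  have on: "cinner (e i) (e j) = (if i = j then 1 else 0)" for i j
    using e by (simp add: orthonormal_basis_def)
  show "U ` e ` {-N..N} \<subseteq> cspan (e ` {-N..N})"
  proof safe
    fix j assume j: "j \<in> {-N..N}"
    let ?v = "\<Sum>i\<in>{-N..N}. cinner (U (e j)) (e i) *\<^sub>C e i"
    have "cinner (U (e j)) (e k) = cinner ?v (e k)" for k
    proof (cases "k \<in> {-N..N}")
      case True
      then show ?thesis
        by (simp add: cinner_sum_left cinner_scaleC_left on if_distrib sum.delta cong: if_cong)
    next
      case False
      then have "U (e k) = e k"
        by (intro fixed) auto
      then have "cinner (U (e j)) (e k) = cinner (e j) (e k)"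
        using U by (metis unitary_def)
      with False j show ?thesis
        by (auto simp: cinner_sum_left cinner_scaleC_left on intro!: sum.neutral[symmetric])
    qed
    then have "U (e j) = ?v"
      by (rule cinner_basis_ext[OF e])
    moreover have "?v \<in> cspan (e ` {-N..N})"
      by (intro complex_vector.span_sum complex_vector.span_scale complex_vector.span_base imageI)
    ultimately show "U (e j) \<in> cspan (e ` {-N..N})"
      by simp
  qed
qed

section \<open>Automatic continuity of star-homomorphisms\<close>

lemma star_uminus: "star (- a) = - star (a :: 'a :: cstar_algebra)"
  using star_scaleC[of "- 1" a] scaleC_of_real[of "- 1"] by simp

lemma star_diff: "star (a - b) = star a - star (b :: 'a :: cstar_algebra)"
  using star_add[of a "- b"] by (simp add: star_uminus)

lemma star_zero [simp]: "star (0 :: 'a :: cstar_algebra) = 0"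
  using star_diff[of 0 "0 :: 'a"] by simp

lemma star_scaleR: "star (r *\<^sub>R a) = r *\<^sub>R star (a :: 'a :: cstar_algebra)"
  using star_scaleC[of "complex_of_real r" a] by (simp add: scaleC_of_real)

lemma norm_star [simp]: "norm (star a) = norm (a :: 'a :: cstar_algebra)"
proof -
  have le: "norm b \<le> norm (star b)" for b :: 'a
  proof (cases "norm b = 0")
    case False
    have "(norm b)\<^sup>2 \<le> norm (star b) * norm b"
      using norm_mult_ineq[of "star b" b] by (simp add: cstar_identity)
    with False show ?thesis
      by (simp add: power2_eq_square)
  qed simp
  from le[of a] le[of "star a"] show ?thesis
    by (simp add: star_star)
qed

lemma continuous_on_star [continuous_intros]:
  fixes f :: "'b::topological_space \<Rightarrow> 'a::cstar_algebra"
  assumes "continuous_on S f"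
  shows "continuous_on S (\<lambda>x. star (f x))"
proof -
  have "bounded_linear (star :: 'a \<Rightarrow> 'a)"
    by (rule bounded_linear_intro[where K = 1]) (simp_all add: star_add star_scaleR)
  then show ?thesis
    using assms by (rule bounded_linear.continuous_on)
qed

lemma continuous_on_scaleC_cstar [continuous_intros]:
  fixes f :: "'b::topological_space \<Rightarrow> 'a::cstar_algebra"
  assumes "continuous_on S f"
  shows "continuous_on S (\<lambda>x. c *\<^sub>C f x)"
proof -
  have "bounded_linear (\<lambda>a :: 'a. c *\<^sub>C a)"
  proof (rule bounded_linear_intro[where K = "cmod c"])
    fix r and x :: 'a
    show "c *\<^sub>C r *\<^sub>R x = r *\<^sub>R c *\<^sub>C x"
      by (simp flip: scaleC_of_real add: scaleC_scaleC mult.commute)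
  qed (simp_all add: scaleC_add_right norm_scaleC mult.commute)
  then show ?thesis
    using assms by (rule bounded_linear.continuous_on)
qed

lemma projection_norm_le_1:
  fixes p :: "'a::cstar_algebra"
  assumes "star p * p = p"
  shows "norm p \<le> 1"
  using cstar_identity[of p] assms by (auto simp: power2_eq_square)

text \<open>The equation says \<open>(1 - v)\<^sup>2 = 1 - z\<close>, without reference to a unit.\<close>

lemma sqrt_one_minus_exists:
  fixes x z :: "'a::cstar_algebra"
  assumes z: "star z = z" "norm z < 1" and comm: "x * z = z * x"
  obtains v where "star v = v" "x * v = v * x" "v + v - v * v = z"
proof -
  \<comment> \<open>\<open>r\<close> is the smaller root of \<open>r = (norm z + r * r) / 2\<close>,
    so \<open>T\<close> maps the ball of radius \<open>r\<close> into itself and contracts it by the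
    factor \<open>r < 1\<close>. Self-adjointness and commutation with \<open>x\<close> are closed
    conditions built into \<open>S\<close>, so the fixed point inherits them.\<close>
  define r where "r = 1 - sqrt (1 - norm z)"
  define S where "S = {v :: 'a. norm v \<le> r \<and> star v = v \<and> x * v = v * x}"
  define T where "T v = (1 / 2 :: real) *\<^sub>R (z + v * v)" for v :: 'a
  have r: "0 \<le> r" "r < 1"
    using z by (auto simp: r_def)
  have "(sqrt (1 - norm z))\<^sup>2 = 1 - norm z"
    using z by simp
  then have rr: "norm z + r * r = 2 * r"
    by (simp add: r_def power2_eq_square algebra_simps)
  have "closed S"
    unfolding S_def by (intro closed_Collect_conj closed_Collect_le closed_Collect_eq continuous_intros)
  then have "complete S"
    by (simp add: complete_eq_closed)
  moreover have "0 \<in> S"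
    using r by (simp add: S_def)
  moreover have "T ` S \<subseteq> S"
  proof safe
    fix v assume v: "v \<in> S"
    have "norm (z + v * v) \<le> norm z + norm v * norm v"
      using norm_triangle_ineq[of z "v * v"] norm_mult_ineq[of v v] by linarith
    also have "\<dots> \<le> norm z + r * r"
      using v r by (auto simp: S_def intro: mult_mono)
    finally have "norm (T v) \<le> r"
      by (simp add: T_def rr)
    moreover have "x * (v * v) = (v * v) * x"
      using v by (metis (mono_tags, lifting) S_def mem_Collect_eq mult.assoc)
    ultimately show "T v \<in> S"
      using v z comm by (simp add: S_def T_def star_scaleR star_add star_mult distrib_left distrib_right)
  qed
  moreover have "dist (T u) (T v) \<le> r * dist u v" if "u \<in> S" "v \<in> S" for u v
  proof -
    have "T u - T v = (1 / 2 :: real) *\<^sub>R (u * (u - v) + (u - v) * v)"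
      by (simp add: T_def algebra_simps)
    moreover have "norm (u * (u - v) + (u - v) * v) \<le> norm u * norm (u - v) + norm (u - v) * norm v"
      using norm_triangle_ineq[of "u * (u - v)" "(u - v) * v"] norm_mult_ineq[of u "u - v"]
        norm_mult_ineq[of "u - v" v] by linarith
    moreover have "\<dots> \<le> r * norm (u - v) + norm (u - v) * r"
      using that r by (intro add_mono mult_mono) (auto simp: S_def)
    ultimately show ?thesis
      by (simp add: dist_norm mult.commute)
  qed
  ultimately obtain v where "v \<in> S" "T v = v"
    using Banach_fix[of S r T] r by blast
  moreover have "T v + T v = z + v * v"
    unfolding T_def by (simp flip: scaleR_add_left)
  ultimately have "z + v * v = v + v"
    by simp
  with \<open>v \<in> S\<close> show ?thesis
    by (intro that[of v]) (auto simp: S_def algebra_simps)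
qed

lemma star_unit:
  fixes one :: "'a::cstar_algebra"
  assumes "\<And>a. one * a = a" "\<And>a. a * one = a"
  shows "star one = one"
  by (metis assms(1) assms(2) star_mult star_star)

lemma half_double: "(1 / 2 :: complex) *\<^sub>C (a + a) = a"
  by (simp add: scaleC_add_right flip: scaleC_add_left)

text \<open>A self-adjoint \<open>x\<close> with \<open>\<parallel>x\<parallel> < 1\<close> is the real part of the isometry
  \<open>u = x + \<i> (1 - x\<^sup>2)\<^bsup>1/2\<^esup>\<close>.\<close>

lemma selfadjoint_real_part_of_isometry:
  fixes one x :: "'a::cstar_algebra"
  assumes one: "\<And>a. one * a = a" "\<And>a. a * one = a" and x: "star x = x" "norm x < 1"
  obtains u where "star u * u = one" "x = (1 / 2 :: complex) *\<^sub>C (u + star u)"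
proof -
  have "norm (x * x) = (norm x)\<^sup>2"
    using cstar_identity[of x] x by simp
  also have "\<dots> < 1"
    using x by (simp add: power_less_one_iff)
  finally obtain v where v: "star v = v" "x * v = v * x" "v + v - v * v = x * x"
    using sqrt_one_minus_exists[of "x * x" x] x by (metis mult.assoc star_mult)
  \<comment> \<open>\<open>w\<close> is a self-adjoint square root of \<open>one - x * x\<close>. It
    commutes with \<open>x\<close>, which cancels the cross terms in
    \<open>star u * u\<close>.\<close>
  define w where "w = one - v"
  define u where "u = x + \<i> *\<^sub>C w"
  have w: "star w = w" "x * w = w * x" "w * w = one - x * x"
    using v(1,2) v(3)[symmetric] by (simp_all add: w_def star_diff star_unit one algebra_simps)
  have star_u: "star u = x - \<i> *\<^sub>C w"
    by (simp add: u_def star_add star_scaleC x w)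
  have "star u * u = x * x + w * w"
    unfolding star_u
    by (simp add: u_def distrib_left left_diff_distrib mult_scaleC_left mult_scaleC_right scaleC_scaleC
        scaleC_minus_one complex_vector.scale_right_diff_distrib w(2))
  then have "star u * u = one"
    by (simp add: w(3))
  moreover have "u + star u = x + x"
    unfolding star_u by (simp add: u_def)
  ultimately show ?thesis
    by (intro that[of u]) (simp_all add: half_double)
qed

lemma star_homD:
  assumes "star_hom type_cstar type_cstar \<rho>"
  shows "\<rho> (a + b) = \<rho> a + \<rho> b" "\<rho> (a * b) = \<rho> a * \<rho> b" "\<rho> (c *\<^sub>C a) = c *\<^sub>C \<rho> a" "\<rho> (star a) = star (\<rho> a)"
  using assms by (simp_all add: star_hom_def)

text \<open>If \<open>u\<close> is an isometry, then
  \<open>(norm (\<rho> u))\<^sup>2 = norm (\<rho> one) \<le> 1\<close>, since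
  \<open>\<rho> one\<close> is a projection even when it is not a unit. The real part of
  \<open>u\<close> therefore has an image of norm at most 1. This settles self-adjoint elements by
  scaling, and the C*-identity then gives the general case.\<close>

lemma star_hom_contractive:
  fixes \<rho> :: "'a::cstar_algebra \<Rightarrow> 'b::cstar_algebra" and one :: 'a
  assumes hom: "star_hom type_cstar type_cstar \<rho>" and one: "\<And>a. one * a = a" "\<And>a. a * one = a"
  shows "norm (\<rho> a) \<le> norm a"
proof -
  note hom = star_homD[OF hom]
  have unit_ball: "norm (\<rho> x) \<le> 1" if x: "star x = x" "norm x < 1" for x
  proof -
    obtain u where u: "star u * u = one" "x = (1 / 2 :: complex) *\<^sub>C (u + star u)"
      by (rule selfadjoint_real_part_of_isometry[OF one x])
    have "norm (\<rho> one) \<le> 1"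
      by (rule projection_norm_le_1) (simp add: hom(2,4)[symmetric] star_unit one)
    then have "(norm (\<rho> u))\<^sup>2 \<le> 1"
      by (metis cstar_identity hom(2) hom(4) u(1))
    then have "norm (\<rho> u) \<le> 1"
      using power2_le_imp_le[of "norm (\<rho> u)" 1] by simp
    moreover have "norm (\<rho> x) = norm (\<rho> u + star (\<rho> u)) / 2"
      by (simp add: u(2) hom norm_scaleC norm_divide)
    ultimately show ?thesis
      using norm_triangle_ineq[of "\<rho> u" "star (\<rho> u)"] by simp
  qed
  have sa: "norm (\<rho> x) \<le> norm x" if "star x = x" for x
  proof (rule field_le_epsilon)
    fix \<epsilon> :: real assume "\<epsilon> > 0"
    \<comment> \<open>The isometry is available only for norm strictly below 1, so the divisor must
      exceed \<open>norm x\<close>.\<close>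
    define c where "c = norm x + \<epsilon>"
    have c: "c > 0" "norm x < c"
      using \<open>\<epsilon> > 0\<close> by (auto simp: c_def add_nonneg_pos)
    have "norm (\<rho> (complex_of_real (1 / c) *\<^sub>C x)) \<le> 1"
      using that c by (intro unit_ball) (auto simp: star_scaleC norm_scaleC norm_divide)
    then have "norm (\<rho> x) / c \<le> 1"
      using c by (simp add: hom norm_scaleC norm_divide)
    then show "norm (\<rho> x) \<le> norm x + \<epsilon>"
      using c(1) by (simp add: divide_le_eq flip: c_def)
  qed
  have "(norm (\<rho> a))\<^sup>2 \<le> (norm a)\<^sup>2"
    using sa[of "star a * a"] by (simp add: hom star_mult star_star cstar_identity)
  then show ?thesis
    by (rule power2_le_imp_le) simp
qed

section \<open>Automorphisms induced by unitaries\<close>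

lemma cstar_generated_subset: "X \<subseteq> cstar_generated X"
  by (auto simp: cstar_generated_def)

lemma cstar_generated_minimal: "cstar_subalgebra B \<Longrightarrow> X \<subseteq> B \<Longrightarrow> cstar_generated X \<subseteq> B"
  by (auto simp: cstar_generated_def)

lemma cstar_subalgebra_generated: "cstar_subalgebra (cstar_generated X)"
  unfolding cstar_generated_def cstar_subalgebra_def by (intro conjI closed_Inter) auto

text \<open>A copy of the algebra on the type over which the universal property quantifies.\<close>

definition lift_cstar :: "('a::cstar_algebra \<times> complex) cstar_struct" where
  "lift_cstar = \<lparr>cs_carrier = UNIV \<times> {0}, cs_zero = (0, 0), cs_add = (\<lambda>a b. (fst a + fst b, 0)),
     cs_scale = (\<lambda>c a. (c *\<^sub>C fst a, 0)), cs_mult = (\<lambda>a b. (fst a * fst b, 0)),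
     cs_star = (\<lambda>a. (star (fst a), 0)), cs_norm = (\<lambda>a. norm (fst a))\<rparr>"

lemma lift_cstar_simps [simp]:
  "cs_carrier (lift_cstar :: ('a::cstar_algebra \<times> complex) cstar_struct) = UNIV \<times> {0}"
  "cs_zero (lift_cstar :: ('a \<times> complex) cstar_struct) = (0, 0)"
  "cs_add (lift_cstar :: ('a \<times> complex) cstar_struct) a b = (fst a + fst b, 0)"
  "cs_scale (lift_cstar :: ('a \<times> complex) cstar_struct) c a = (c *\<^sub>C fst a, 0)"
  "cs_mult (lift_cstar :: ('a \<times> complex) cstar_struct) a b = (fst a * fst b, 0)"
  "cs_star (lift_cstar :: ('a \<times> complex) cstar_struct) a = (star (fst a), 0)"
  "cs_norm (lift_cstar :: ('a \<times> complex) cstar_struct) a = norm (fst a)"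
  by (simp_all add: lift_cstar_def)

lemma cstar_algebra_on_lift_cstar:
  "cstar_algebra_on (lift_cstar :: ('a::cstar_algebra \<times> complex) cstar_struct)"
proof -
  let ?M = "UNIV \<times> {0} :: ('a \<times> complex) set" and ?d = "\<lambda>a b :: 'a \<times> complex. norm (fst a - fst b)"
  have tri: "norm (a - c) \<le> norm (a - b) + norm (b - c)" for a b c :: 'a
    using norm_triangle_ineq[of "a - b" "b - c"] by simp
  interpret Metric_space ?M ?d
    by unfold_locales (auto intro: norm_minus_commute tri)
  have mcomplete
    unfolding mcomplete_def
  proof (intro allI impI)
    fix \<sigma> assume \<sigma>: "MCauchy \<sigma>"
    then have "Cauchy (\<lambda>n. fst (\<sigma> n))"
      by (auto simp: MCauchy_def Cauchy_def dist_norm)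
    then obtain l where "(\<lambda>n. fst (\<sigma> n)) \<longlonglongrightarrow> l"
      using Cauchy_convergent convergent_def by blast
    moreover have "\<sigma> n \<in> ?M" for n
      using \<sigma> by (auto simp: MCauchy_def)
    ultimately have "limitin mtopology \<sigma> (l, 0) sequentially"
      by (simp add: mem_Times_iff limit_metric_sequentially lim_sequentially dist_norm)
    then show "\<exists>l. limitin mtopology \<sigma> l sequentially" ..
  qed
  then show ?thesis
    by unfold_locales
      (auto simp: scaleC_minus_one scaleC_add_left scaleC_add_right scaleC_scaleC algebra_simps
        mult_scaleC_left mult_scaleC_right norm_scaleC Defs.star_star Defs.star_add
        star_scaleC Defs.star_mult Defs.cstar_identity norm_triangle_ineq norm_mult_ineq)
qed

locale ccr =
  fixes W :: "'h::complex_hilbert \<Rightarrow> 'a::cstar_algebra"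
  assumes ccr: "ccr_algebra W"
begin

lemma W_star: "star (W x) = W (- x)"
  and W_mult: "W x * W y = exp (\<i> * complex_of_real (symp x y)) *\<^sub>C W (x + y)"
  using ccr by (simp_all add: ccr_algebra_def weyl_relations_def)

text \<open>The elements on which \<open>W 0\<close> acts as a two-sided unit form a C*-subalgebra,
  and by the Weyl relations it contains every generator.\<close>

lemma unit [simp]: "W 0 * a = a" "a * W 0 = a"
proof -
  let ?B = "{a. W 0 * a = a \<and> a * W 0 = a}"
  have W0: "star (W 0) = W 0"
    by (simp add: W_star)
  have "star a \<in> ?B" if "a \<in> ?B" for a
    using that star_mult[of a "W 0"] star_mult[of "W 0" a] by (simp add: W0)
  moreover have "a * b \<in> ?B" if "a \<in> ?B" "b \<in> ?B" for a b
    using that by (simp add: mult.assoc) (simp flip: mult.assoc)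
  moreover have "closed ?B"
    by (intro closed_Collect_conj closed_Collect_eq continuous_intros)
  ultimately have "cstar_subalgebra ?B"
    by (simp add: cstar_subalgebra_def distrib_left distrib_right mult_scaleC_left mult_scaleC_right)
  moreover have "range W \<subseteq> ?B"
    by (auto simp: W_mult symp_def)
  ultimately have "cstar_generated (range W) \<subseteq> ?B"
    by (rule cstar_generated_minimal)
  then show "W 0 * a = a" "a * W 0 = a"
    using ccr by (auto simp: ccr_algebra_def)
qed

lemma norm_W: "norm (W x) \<le> 1"
proof -
  have "(norm (W x))\<^sup>2 = norm (W 0)"
    using cstar_identity[of "W x"]
    by (simp add: W_star W_mult symp_def cinner_minus_left cinner_self)
  moreover have "norm (W 0) \<le> 1"
    by (rule projection_norm_le_1) (simp add: W_star)
  ultimately show ?thesis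
    using power2_le_imp_le[of "norm (W x)" 1] by simp
qed

text \<open>\<open>U\<close> preserves \<open>symp\<close>, so the elements \<open>W (U x)\<close>
  again satisfy the Weyl relations and the universal property applies with target
  \<open>lift_cstar\<close>. Projecting to the first component gives existence; lifting two
  candidates into \<open>lift_cstar\<close> gives uniqueness.\<close>

lemma
  assumes U: "unitary U"
  shows weyl_hom_star_hom: "star_hom type_cstar type_cstar (weyl_hom W U)"
    and weyl_hom_W: "weyl_hom W U (W x) = W (U x)"
proof -
  have lin: "clinear U" and symp: "symp (U x) (U y) = symp x y" for x y
    using U by (simp_all add: unitary_def symp_def)
  have "weyl_relations lift_cstar (\<lambda>x. (W (U x), 0 :: complex))"
    by (simp add: weyl_relations_def W_star W_mult symp clinear_uminus[OF lin] clinear_add[OF lin])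
  then have ex1: "\<exists>!\<phi>. star_hom type_cstar lift_cstar \<phi> \<and> (\<forall>x. \<phi> (W x) = (W (U x), 0 :: complex))"
    using ccr cstar_algebra_on_lift_cstar unfolding ccr_algebra_def by blast
  have "\<exists>!\<rho>. star_hom type_cstar type_cstar \<rho> \<and> (\<forall>x. \<rho> (W x) = W (U x))"
  proof (rule ex_ex1I)
    obtain \<phi> where "star_hom type_cstar lift_cstar \<phi>" "\<forall>x. \<phi> (W x) = (W (U x), 0 :: complex)"
      using ex1 by blast
    then show "\<exists>\<rho>. star_hom type_cstar type_cstar \<rho> \<and> (\<forall>x. \<rho> (W x) = W (U x))"
      by (intro exI[of _ "\<lambda>a. fst (\<phi> a)"]) (auto simp: star_hom_def)
  next
    fix \<rho> \<rho>'
    assume \<rho>: "star_hom type_cstar type_cstar \<rho> \<and> (\<forall>x. \<rho> (W x) = W (U x))"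
      and \<rho>': "star_hom type_cstar type_cstar \<rho>' \<and> (\<forall>x. \<rho>' (W x) = W (U x))"
    have "(\<lambda>a. (\<rho> a, 0 :: complex)) = (\<lambda>a. (\<rho>' a, 0))"
      using \<rho> \<rho>' by (intro trans[OF the1_equality[OF ex1, symmetric] the1_equality[OF ex1]]) (simp_all add: star_hom_def)
    then show "\<rho> = \<rho>'"
      by (simp add: fun_eq_iff)
  qed
  from theI'[OF this] show "star_hom type_cstar type_cstar (weyl_hom W U)" "weyl_hom W U (W x) = W (U x)"
    unfolding weyl_hom_def by blast+
qed

lemma norm_weyl_hom: "unitary U \<Longrightarrow> norm (weyl_hom W U a) \<le> norm a"
  by (rule star_hom_contractive[OF weyl_hom_star_hom unit])

end

section \<open>States on the local algebra\<close>

lemma cstar_subalgebraD: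
  assumes "cstar_subalgebra B"
  shows "closed B" "0 \<in> B" "a \<in> B \<Longrightarrow> star a \<in> B" "a \<in> B \<Longrightarrow> c *\<^sub>C a \<in> B"
    "a \<in> B \<Longrightarrow> b \<in> B \<Longrightarrow> a + b \<in> B" "a \<in> B \<Longrightarrow> b \<in> B \<Longrightarrow> a * b \<in> B"
  using assms by (auto simp: cstar_subalgebra_def)

lemma cstar_subalgebra_diff: "cstar_subalgebra B \<Longrightarrow> a \<in> B \<Longrightarrow> b \<in> B \<Longrightarrow> a - b \<in> B"
  using cstar_subalgebraD(5)[of B a "(- 1) *\<^sub>C b"] cstar_subalgebraD(4)[of B b "- 1"]
  by (simp add: scaleC_minus_one)

lemma cstar_subalgebra_sum: "cstar_subalgebra B \<Longrightarrow> (\<And>i. i \<in> I \<Longrightarrow> f i \<in> B) \<Longrightarrow> sum f I \<in> B"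
  by (induction I rule: infinite_finite_induct) (auto intro: cstar_subalgebraD)

lemma cspan_subset_cstar_subalgebra:
  assumes "cstar_subalgebra B" "X \<subseteq> B"
  shows "cspan X \<subseteq> B"
proof
  show "a \<in> B" if "a \<in> cspan X" for a
    using that by (induction rule: complex_vector.span_induct_alt)
      (use assms in \<open>auto intro: cstar_subalgebraD\<close>)
qed

lemma
  assumes "state_on B \<omega>"
  shows state_on_add: "a \<in> B \<Longrightarrow> b \<in> B \<Longrightarrow> \<omega> (a + b) = \<omega> a + \<omega> b"
    and state_on_scaleC: "a \<in> B \<Longrightarrow> \<omega> (c *\<^sub>C a) = c * \<omega> a"
    and state_on_Re_nonneg: "a \<in> B \<Longrightarrow> 0 \<le> Re (\<omega> (star a * a))"
    and state_on_Im_zero: "a \<in> B \<Longrightarrow> Im (\<omega> (star a * a)) = 0"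
    and state_on_outside: "a \<notin> B \<Longrightarrow> \<omega> a = 0"
  using assms by (auto simp: state_on_def complex_nonneg_Reals_iff)

context
  fixes B :: "'a::cstar_algebra set" and \<omega>
  assumes B: "cstar_subalgebra B" and \<omega>: "state_on B \<omega>"
begin

lemma state_on_zero: "\<omega> 0 = 0"
  using state_on_scaleC[OF \<omega> cstar_subalgebraD(2)[OF B], of 0] by simp

lemma state_on_diff: "a \<in> B \<Longrightarrow> b \<in> B \<Longrightarrow> \<omega> (a - b) = \<omega> a - \<omega> b"
  using state_on_add[OF \<omega>, of "a - b" b] cstar_subalgebra_diff[OF B] by simp

lemma state_on_sum: "(\<And>i. i \<in> I \<Longrightarrow> f i \<in> B) \<Longrightarrow> \<omega> (sum f I) = (\<Sum>i\<in>I. \<omega> (f i))"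
  by (induction I rule: infinite_finite_induct)
    (simp_all add: state_on_zero state_on_add[OF \<omega>] cstar_subalgebra_sum[OF B])

lemma state_on_cmod_le_1: "a \<in> B \<Longrightarrow> norm a \<le> 1 \<Longrightarrow> cmod (\<omega> a) \<le> 1"
  using \<omega> cSUP_upper[of a "{a \<in> B. norm a \<le> 1}" "\<lambda>a. cmod (\<omega> a)"] by (simp add: state_on_def)

lemma state_on_cmod_le_norm:
  assumes a: "a \<in> B"
  shows "cmod (\<omega> a) \<le> norm a"
proof (cases "a = 0")
  case False
  let ?r = "complex_of_real (1 / norm a)"
  have "cmod (\<omega> (?r *\<^sub>C a)) \<le> 1"
    using False a B by (intro state_on_cmod_le_1) (auto simp: norm_scaleC norm_divide intro: cstar_subalgebraD)
  then show ?thesis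
    using False a by (simp add: state_on_scaleC[OF \<omega>] norm_mult norm_divide divide_le_eq)
qed (simp add: state_on_zero)

section \<open>Hermiticity, Cauchy-Schwarz and the value of a state at the unit\<close>

context
  fixes one :: 'a
  assumes one: "\<And>a. one * a = a" "\<And>a. a * one = a" "one \<in> B"
begin

lemma state_on_square_expand:
  assumes c: "c \<in> B"
  shows "\<omega> (star (c + z *\<^sub>C one) * (c + z *\<^sub>C one)) =
    \<omega> (star c * c) + z * \<omega> (star c) + cnj z * \<omega> c + complex_of_real ((cmod z)\<^sup>2) * \<omega> one"
proof -
  have "star (c + z *\<^sub>C one) * (c + z *\<^sub>C one) =
      star c * c + z *\<^sub>C star c + cnj z *\<^sub>C c + complex_of_real ((cmod z)\<^sup>2) *\<^sub>C one"
    unfolding complex_norm_square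
    by (simp add: star_add star_scaleC star_unit one distrib_left distrib_right scaleC_add_right mult_scaleC_left
        mult_scaleC_right scaleC_scaleC mult.commute)
  then show ?thesis
    using c one(3) B by (simp add: state_on_add[OF \<omega>] state_on_scaleC[OF \<omega>] cstar_subalgebraD)
qed

lemma state_on_one_nonneg: "Im (\<omega> one) = 0 \<and> 0 \<le> Re (\<omega> one)"
  using state_on_Re_nonneg[OF \<omega> one(3)] state_on_Im_zero[OF \<omega> one(3)] by (simp add: star_unit one)

text \<open>By positivity the expanded square is real for every \<open>z\<close>. The choice
  \<open>z = 1\<close> compares imaginary parts and \<open>z = \<i>\<close> compares real
  parts.\<close>

lemma state_on_star:
  assumes c: "c \<in> B"
  shows "\<omega> (star c) = cnj (\<omega> c)"
proof -
  have "Im (z * \<omega> (star c) + cnj z * \<omega> c) = 0" for z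
  proof -
    have "c + z *\<^sub>C one \<in> B"
      using c one(3) B by (intro cstar_subalgebraD)
    from state_on_Im_zero[OF \<omega> this] state_on_Im_zero[OF \<omega> c] state_on_one_nonneg show ?thesis
      unfolding state_on_square_expand[OF c] by simp
  qed
  from this[of 1] this[of \<i>] show ?thesis
    by (simp add: complex_eq_iff)
qed

text \<open>Positivity at \<open>c - \<omega> c *\<^sub>C one\<close>. The factor
  \<open>2 - Re (\<omega> one)\<close> stays because normalisation is a statement about the norm of
  \<open>\<omega>\<close>; it becomes 1 once \<open>state_on_one\<close> is proved.\<close>

lemma state_on_Cauchy_Schwarz_aux:
  assumes c: "c \<in> B"
  shows "(cmod (\<omega> c))\<^sup>2 * (2 - Re (\<omega> one)) \<le> Re (\<omega> (star c * c))"
proof -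
  let ?z = "- \<omega> c"
  have "c + ?z *\<^sub>C one \<in> B"
    using c one(3) B by (intro cstar_subalgebraD)
  moreover have "cmod (\<omega> c) * cmod (\<omega> c) = Re (\<omega> c) * Re (\<omega> c) + Im (\<omega> c) * Im (\<omega> c)"
    using cmod_power2[of "\<omega> c"] by (simp add: power2_eq_square)
  ultimately show ?thesis
    using state_on_Re_nonneg[OF \<omega>, of "c + ?z *\<^sub>C one"]
    unfolding state_on_square_expand[OF c] state_on_star[OF c]
    by (simp add: algebra_simps power2_eq_square)
qed

lemma norm_one_le_1: "norm one \<le> 1"
  by (rule projection_norm_le_1) (simp add: star_unit one)

text \<open>Taking the supremum over the unit ball in the preceding inequality forces \<open>2 - \<omega>(1) \<le> 1\<close>.\<close>

lemma state_on_one: "\<omega> one = 1"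
proof -
  have le: "Re (\<omega> one) \<le> 1"
    using state_on_cmod_le_1[OF one(3) norm_one_le_1] complex_Re_le_cmod[of "\<omega> one"] by linarith
  have "cmod (\<omega> a) \<le> sqrt (1 / (2 - Re (\<omega> one)))" if a: "a \<in> B" "norm a \<le> 1" for a
  proof (rule real_le_rsqrt)
    have "star a * a \<in> B" "norm (star a * a) \<le> 1"
      using a B by (auto intro: cstar_subalgebraD simp: cstar_identity power_le_one)
    then have "Re (\<omega> (star a * a)) \<le> 1"
      using state_on_cmod_le_1 complex_Re_le_cmod order_trans by blast
    then have "(cmod (\<omega> a))\<^sup>2 * (2 - Re (\<omega> one)) \<le> 1"
      using state_on_Cauchy_Schwarz_aux[OF a(1)] by linarith
    then show "(cmod (\<omega> a))\<^sup>2 \<le> 1 / (2 - Re (\<omega> one))"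
      using le by (simp add: field_simps)
  qed
  moreover have "{a \<in> B. norm a \<le> 1} \<noteq> {}"
    using cstar_subalgebraD(2)[OF B] by (auto intro!: exI[of _ 0])
  ultimately have "(SUP a\<in>{a \<in> B. norm a \<le> 1}. cmod (\<omega> a)) \<le> sqrt (1 / (2 - Re (\<omega> one)))"
    by (intro cSUP_least) auto
  then have "1 \<le> sqrt (1 / (2 - Re (\<omega> one)))"
    using \<omega> by (simp add: state_on_def)
  then have "1 \<le> Re (\<omega> one)"
    using le by (simp add: field_simps)
  then show ?thesis
    using le state_on_one_nonneg by (simp add: complex_eq_iff)
qed

lemma state_on_Cauchy_Schwarz: "c \<in> B \<Longrightarrow> (cmod (\<omega> c))\<^sup>2 \<le> Re (\<omega> (star c * c))"
  using state_on_Cauchy_Schwarz_aux[of c] by (simp add: state_on_one)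

end

end

text \<open>The bound makes the supremum over the unit ball at most 1, and the value 1 is attained
  at \<open>one\<close>.\<close>

lemma state_onI:
  fixes one :: "'a::cstar_algebra"
  assumes "\<And>a b. a \<in> B \<Longrightarrow> b \<in> B \<Longrightarrow> \<omega> (a + b) = \<omega> a + \<omega> b"
    and "\<And>c a. a \<in> B \<Longrightarrow> \<omega> (c *\<^sub>C a) = c * \<omega> a"
    and "\<And>a. a \<in> B \<Longrightarrow> \<omega> (star a * a) \<in> \<real>\<^sub>\<ge>\<^sub>0"
    and le: "\<And>a. a \<in> B \<Longrightarrow> cmod (\<omega> a) \<le> norm a"
    and one: "one \<in> B" "norm one \<le> 1" "\<omega> one = 1"
    and "\<And>a. a \<notin> B \<Longrightarrow> \<omega> a = 0"
  shows "state_on B \<omega>"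
proof -
  let ?A = "{a \<in> B. norm a \<le> 1}"
  have le1: "cmod (\<omega> a) \<le> 1" if "a \<in> ?A" for a
    using le that by force
  then have bdd: "bdd_above ((\<lambda>a. cmod (\<omega> a)) ` ?A)"
    by (intro bdd_aboveI[of _ 1]) auto
  moreover have "(SUP a\<in>?A. cmod (\<omega> a)) = 1"
  proof (rule antisym)
    show "(SUP a\<in>?A. cmod (\<omega> a)) \<le> 1"
      using le1 one by (intro cSUP_least) auto
    show "1 \<le> (SUP a\<in>?A. cmod (\<omega> a))"
      using cSUP_upper[OF _ bdd, of one] one by simp
  qed
  ultimately show ?thesis
    using assms by (simp add: state_on_def)
qed

section \<open>Invariant states\<close>

locale ccr_basis = ccr W for W :: "'h::complex_hilbert \<Rightarrow> 'a::cstar_algebra" +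
  fixes e :: "int \<Rightarrow> 'h"
  assumes basis: "orthonormal_basis e"
begin

abbreviation H0 :: "'h set" where "H0 \<equiv> cspan (range e)"

abbreviation B0 :: "'a set" where "B0 \<equiv> local_algebra e W"

lemma B0: "cstar_subalgebra B0"
  unfolding local_algebra_def by (rule cstar_subalgebra_generated)

lemma W_in_B0: "x \<in> H0 \<Longrightarrow> W x \<in> B0"
  unfolding local_algebra_def by (rule subsetD[OF cstar_generated_subset imageI])

lemma one_in_B0: "W 0 \<in> B0"
  by (rule W_in_B0) (rule complex_vector.span_zero)

text \<open>Adjoints of Weyl elements are Weyl elements and products are scalar multiples of them,
  so their span is a star-algebra. By continuity its closure is a C*-subalgebra containing the
  generators.\<close>

lemma B0_subset_closure: "B0 \<subseteq> closure (cspan (W ` H0))"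
  unfolding local_algebra_def
proof (rule cstar_generated_minimal)
  let ?S = "cspan (W ` H0)"
  note span = complex_vector.span_base complex_vector.span_scale complex_vector.span_add complex_vector.span_zero
  have star: "star a \<in> ?S" if "a \<in> ?S" for a
    using that
  proof (induction rule: complex_vector.span_induct_alt)
    case (step c b a)
    then obtain x where "b = W x" "x \<in> H0" by auto
    then have "star b \<in> ?S"
      by (simp add: W_star span(1) complex_vector.span_neg)
    then show ?case
      using step unfolding star_add star_scaleC by (intro span(2,3))
  qed (simp add: span)
  have W_mem: "W x * b \<in> ?S" if "x \<in> H0" "b \<in> ?S" for x b
    using that(2)
  proof (induction rule: complex_vector.span_induct_alt)
    case (step c b a)
    then obtain y where y: "b = W y" "y \<in> H0" by auto
    have "W (x + y) \<in> ?S"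
      using span(3)[OF that(1) y(2)] by (rule span(1)[OF imageI])
    then have "W x * b \<in> ?S"
      unfolding y(1) W_mult by (rule span(2))
    then show ?case
      using step unfolding distrib_left mult_scaleC_right by (intro span(2,3))
  qed (simp add: span)
  have mult: "a * b \<in> ?S" if "a \<in> ?S" "b \<in> ?S" for a b
    using that(1)
  proof (induction rule: complex_vector.span_induct_alt)
    case (step c d a)
    then have "d * b \<in> ?S"
      using W_mem that(2) by auto
    then show ?case
      using step unfolding distrib_right mult_scaleC_left by (intro span(2,3))
  qed (simp add: span)
  have sub: "a \<in> closure ?S" if "a \<in> ?S" for a
    using closure_subset that by (rule subsetD)
  \<comment> \<open>A continuous map sending the span into its closure preserves the closure. Sums
    and products are handled by applying this to one argument at a time.\<close>
  have cl: "f a \<in> closure ?S"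
    if "continuous_on UNIV f" "\<And>a. a \<in> ?S \<Longrightarrow> f a \<in> closure ?S" "a \<in> closure ?S" for f :: "'a \<Rightarrow> 'a" and a
  proof -
    have "f ` closure ?S \<subseteq> closure ?S"
      by (rule image_closure_subset[OF continuous_on_subset[OF that(1)]]) (use that(2) in auto)
    then show ?thesis using that(3) by auto
  qed
  have star': "star a \<in> closure ?S" if "a \<in> closure ?S" for a
    by (rule cl[OF _ _ that, of "star"]) (intro continuous_intros, rule sub, rule star)
  have scale': "c *\<^sub>C a \<in> closure ?S" if "a \<in> closure ?S" for a c
    by (rule cl[OF _ _ that, of "\<lambda>a. c *\<^sub>C a"]) (intro continuous_intros, rule sub, rule span(2))
  have add1: "a + b \<in> closure ?S" if "a \<in> ?S" "b \<in> closure ?S" for a b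
    by (rule cl[OF _ _ that(2), of "\<lambda>b. a + b"]) (intro continuous_intros, rule sub, rule span(3)[OF that(1)])
  have add': "a + b \<in> closure ?S" if "a \<in> closure ?S" "b \<in> closure ?S" for a b
    by (rule cl[OF _ _ that(1), of "\<lambda>a. a + b"]) (intro continuous_intros, rule add1[OF _ that(2)])
  have mult1: "a * b \<in> closure ?S" if "a \<in> ?S" "b \<in> closure ?S" for a b
    by (rule cl[OF _ _ that(2), of "\<lambda>b. a * b"]) (intro continuous_intros, rule sub, rule mult[OF that(1)])
  have mult': "a * b \<in> closure ?S" if "a \<in> closure ?S" "b \<in> closure ?S" for a b
    by (rule cl[OF _ _ that(1), of "\<lambda>a. a * b"]) (intro continuous_intros, rule mult1[OF _ that(2)])
  show "cstar_subalgebra (closure ?S)"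
    unfolding cstar_subalgebra_def
    by (intro conjI ballI allI closed_closure star' scale' add' mult') (use sub span(4) in auto)
  show "W ` H0 \<subseteq> closure ?S"
    by (intro subsetI sub span(1))
qed

text \<open>The common setting for the three groups and the shift: the second condition makes the
  induced homomorphism restrict to \<open>B0\<close>.\<close>

definition localized :: "('h \<Rightarrow> 'h) \<Rightarrow> bool" where
  "localized U \<longleftrightarrow> unitary U \<and> U ` H0 \<subseteq> H0"

text \<open>The preimage of \<open>B0\<close> is a C*-subalgebra, closed because the homomorphism is
  contractive, and it contains the generators of \<open>B0\<close>.\<close>

lemma weyl_hom_B0:
  assumes U: "localized U" and a: "a \<in> B0"
  shows "weyl_hom W U a \<in> B0"
proof -
  have U: "unitary U" "U ` H0 \<subseteq> H0"
    using U by (auto simp: localized_def)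
  note hom = star_homD[OF weyl_hom_star_hom[OF U(1)]]
  have "dist (weyl_hom W U a) (weyl_hom W U b) \<le> dist a b" for a b
    using norm_weyl_hom[OF U(1), of "a - b"] hom(1)[of "a - b" b] by (simp add: dist_norm)
  then have "continuous_on UNIV (weyl_hom W U)"
    by (auto simp: continuous_on_iff intro: le_less_trans)
  then have "closed (weyl_hom W U -` B0)"
    using continuous_closed_vimage[of B0 "weyl_hom W U"] cstar_subalgebraD(1)[OF B0]
    by (simp add: continuous_on_eq_continuous_at)
  moreover have "weyl_hom W U 0 = 0"
    using hom(3)[of 0 0] by simp
  ultimately have "cstar_subalgebra (weyl_hom W U -` B0)"
    using B0 by (simp add: cstar_subalgebra_def hom)
  moreover have "W ` H0 \<subseteq> weyl_hom W U -` B0"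
    using U by (auto simp: weyl_hom_W intro!: W_in_B0)
  ultimately have "B0 \<subseteq> weyl_hom W U -` B0"
    unfolding local_algebra_def[of e W] by (intro cstar_generated_minimal) (simp_all add: local_algebra_def)
  then show ?thesis
    using a by blast
qed

text \<open>Equality on Weyl elements passes to their span by linearity and then to
  \<open>B0\<close> by approximation, as both the state and the induced homomorphism are
  contractive.\<close>

lemma state_invariant_iff:
  assumes U: "localized U" and \<omega>: "state_on B0 \<omega>"
  shows "(\<forall>a\<in>B0. \<omega> (weyl_hom W U a) = \<omega> a) \<longleftrightarrow> (\<forall>x\<in>H0. \<omega> (W (U x)) = \<omega> (W x))"
proof
  have un: "unitary U"
    using U by (simp add: localized_def)
  note hom = star_homD[OF weyl_hom_star_hom[OF un]]
  show "\<forall>x\<in>H0. \<omega> (W (U x)) = \<omega> (W x)" if "\<forall>a\<in>B0. \<omega> (weyl_hom W U a) = \<omega> a"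
    using that W_in_B0 by (simp flip: weyl_hom_W[OF un])
  assume inv: "\<forall>x\<in>H0. \<omega> (W (U x)) = \<omega> (W x)"
  have sub: "cspan (W ` H0) \<subseteq> B0"
    by (rule cspan_subset_cstar_subalgebra[OF B0]) (auto intro: W_in_B0)
  have dense: "a \<in> B0 \<and> \<omega> (weyl_hom W U a) = \<omega> a" if "a \<in> cspan (W ` H0)" for a
    using that
  proof (induction rule: complex_vector.span_induct_alt)
    case base
    have "weyl_hom W U 0 = 0"
      using hom(3)[of 0 0] by simp
    then show ?case
      by (simp add: cstar_subalgebraD(2)[OF B0])
  next
    case (step c b a)
    then obtain x where x: "b = W x" "x \<in> H0" by auto
    have "a \<in> B0" "b \<in> B0"
      using step x W_in_B0 by auto
    then have "weyl_hom W U a \<in> B0" "weyl_hom W U b \<in> B0" "a \<in> B0" "b \<in> B0"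
      using weyl_hom_B0[OF U] by auto
    then show ?case
      using step x inv B0
      by (simp add: hom cstar_subalgebraD(5) state_on_add[OF \<omega>] state_on_scaleC[OF \<omega>] cstar_subalgebraD(4) weyl_hom_W[OF un])
  qed
  show "\<forall>a\<in>B0. \<omega> (weyl_hom W U a) = \<omega> a"
  proof
    fix a assume a: "a \<in> B0"
    have "cmod (\<omega> (weyl_hom W U a) - \<omega> a) \<le> 0"
    proof (rule field_le_epsilon)
      fix \<epsilon> :: real assume "\<epsilon> > 0"
      moreover have "a \<in> closure (cspan (W ` H0))"
        using B0_subset_closure a by blast
      ultimately obtain b where b: "b \<in> cspan (W ` H0)" "norm (a - b) < \<epsilon> / 2"
        unfolding closure_approachable dist_norm norm_minus_commute[of _ a] by (meson half_gt_zero)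
      have ab: "a - b \<in> B0" "b \<in> B0"
        using cstar_subalgebra_diff[OF B0] a b(1) sub by auto
      have "\<omega> (weyl_hom W U a) - \<omega> a = \<omega> (weyl_hom W U (a - b)) - \<omega> (a - b)"
        using hom(1)[of "a - b" b] weyl_hom_B0[OF U ab(1)] weyl_hom_B0[OF U ab(2)] dense[OF b(1)]
          state_on_add[OF \<omega> ab]
        by (simp add: state_on_add[OF \<omega>])
      also have "cmod \<dots> \<le> norm (weyl_hom W U (a - b)) + norm (a - b)"
        using norm_triangle_ineq4[of "\<omega> (weyl_hom W U (a - b))" "\<omega> (a - b)"]
          state_on_cmod_le_norm[OF B0 \<omega> ab(1)] state_on_cmod_le_norm[OF B0 \<omega> weyl_hom_B0[OF U ab(1)]]
        by linarith
      also have "\<dots> \<le> \<epsilon>"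
        using norm_weyl_hom[OF un, of "a - b"] b(2) by simp
      finally show "cmod (\<omega> (weyl_hom W U a) - \<omega> a) \<le> 0 + \<epsilon>" by simp
    qed
    then show "\<omega> (weyl_hom W U a) = \<omega> a" by simp
  qed
qed

lemma invariant_states_iff:
  assumes "\<And>U. U \<in> G \<Longrightarrow> localized U"
  shows "\<omega> \<in> invariant_states e W G \<longleftrightarrow>
    state_on B0 \<omega> \<and> (\<forall>U\<in>G. \<forall>x\<in>H0. \<omega> (W (U x)) = \<omega> (W x))"
  unfolding invariant_states_def using state_invariant_iff assms by blast

text \<open>Norm one survives convex combinations because every state takes the value 1 at
  \<open>W 0\<close>.\<close>

lemma convex_invariant_states: "convex (invariant_states e W G)"
  unfolding convex_alt
proof safe
  fix \<phi> \<psi> and t :: real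
  assume \<phi>\<psi>: "\<phi> \<in> invariant_states e W G" "\<psi> \<in> invariant_states e W G" and t: "0 \<le> t" "t \<le> 1"
  let ?\<omega> = "(1 - t) *\<^sub>R \<phi> + t *\<^sub>R \<psi>"
  have \<phi>: "state_on B0 \<phi>" and \<psi>: "state_on B0 \<psi>"
    using \<phi>\<psi> by (auto simp: invariant_states_def)
  have \<omega>: "?\<omega> a = complex_of_real (1 - t) * \<phi> a + complex_of_real t * \<psi> a" for a
    by (simp add: scaleR_fun_def scaleR_conv_of_real)
  have "state_on B0 ?\<omega>"
  proof (rule state_onI[where one = "W 0"])
    fix a assume a: "a \<in> B0"
    show "?\<omega> (star a * a) \<in> \<real>\<^sub>\<ge>\<^sub>0"
      using state_on_Re_nonneg[OF \<phi> a] state_on_Im_zero[OF \<phi> a] state_on_Re_nonneg[OF \<psi> a]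
        state_on_Im_zero[OF \<psi> a] t
      unfolding \<omega> by (simp add: complex_nonneg_Reals_iff)
    have "cmod (?\<omega> a) \<le> (1 - t) * cmod (\<phi> a) + t * cmod (\<psi> a)"
      unfolding \<omega> using norm_triangle_ineq[of "complex_of_real (1 - t) * \<phi> a" "complex_of_real t * \<psi> a"] t
      by (simp add: norm_mult del: of_real_diff)
    also have "\<dots> \<le> (1 - t) * norm a + t * norm a"
      using t state_on_cmod_le_norm[OF B0 \<phi> a] state_on_cmod_le_norm[OF B0 \<psi> a]
      by (intro add_mono mult_left_mono) auto
    finally show "cmod (?\<omega> a) \<le> norm a"
      by (simp add: algebra_simps)
  next
    show "?\<omega> (W 0) = 1"
      unfolding \<omega> by (simp add: state_on_one[OF B0 \<phi> unit one_in_B0] state_on_one[OF B0 \<psi> unit one_in_B0])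
  next
    show "?\<omega> a = 0" if "a \<notin> B0" for a
      unfolding \<omega> using that by (simp add: state_on_outside[OF \<phi>] state_on_outside[OF \<psi>])
  qed (simp_all only: \<omega> state_on_add[OF \<phi>] state_on_add[OF \<psi>] state_on_scaleC[OF \<phi>] state_on_scaleC[OF \<psi>]
      one_in_B0 norm_W, simp_all add: algebra_simps)
  then show "?\<omega> \<in> invariant_states e W G"
    using \<phi>\<psi> unfolding invariant_states_def by (simp add: scaleR_fun_def)
qed

section \<open>Translates of local unitaries and the face property\<close>


text \<open>The \<open>n\<close>-th power of the shift, for negative \<open>n\<close> as
  well.\<close>

definition translate :: "int \<Rightarrow> 'h \<Rightarrow> 'h" where
  "translate n = basis_unitary e (\<lambda>i. i + n)"

lemma bij_add_int: "bij (\<lambda>i :: int. i + n)"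
  by (rule o_bij[of "\<lambda>i. i - n"]) auto

lemma localized_basis_unitary: "bij s \<Longrightarrow> localized (basis_unitary e s)"
  unfolding localized_def
proof (intro conjI image_subsetI)
  assume s: "bij s"
  show U: "unitary (basis_unitary e s)"
    by (rule unitary_basis_unitary[OF basis s])
  have "clinear (basis_unitary e s)"
    using U by (simp add: unitary_def)
  then show "basis_unitary e s x \<in> H0" if "x \<in> H0" for x
    using that
  proof (rule clinear_cspan_mono)
    show "basis_unitary e s ` range e \<subseteq> H0"
      by (simp add: image_subset_iff basis_unitary_apply[OF basis s] complex_vector.span_base)
  qed
qed

lemma localized_shift: "localized (shift e)"
  unfolding shift_def by (rule localized_basis_unitary) (rule bij_add_int)

lemma clinear_localized: "localized U \<Longrightarrow> clinear U"
  by (simp add: localized_def unitary_def)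

lemma localized_H0: "localized U \<Longrightarrow> x \<in> H0 \<Longrightarrow> U x \<in> H0"
  by (auto simp: localized_def)

lemma localized_translate: "localized (translate n)"
  unfolding translate_def by (rule localized_basis_unitary) (rule bij_add_int)

lemma translate_translate: "translate m (translate n x) = translate (n + m) x"
  by (simp add: translate_def basis_unitary_comp[OF basis bij_add_int bij_add_int] comp_def add.assoc)

lemma translate_zero: "translate 0 x = x"
  using basis_unitary_id[OF basis] by (simp add: translate_def)

lemma translate_apply: "translate n (e i) = e (i + n)"
  unfolding translate_def by (rule basis_unitary_apply[OF basis bij_add_int])

lemma unitary_translate: "unitary (translate n)"
  using localized_translate by (simp add: localized_def)

lemma shift_eq_translate: "shift e = translate 1"
  by (simp add: shift_def translate_def)

text \<open>A window containing the support of \<open>x\<close> and all sites moved by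
  \<open>U\<close> is preserved by \<open>U\<close>.\<close>

lemma localized_U_Z:
  assumes "U \<in> U_Z e"
  shows "localized U"
proof -
  obtain M where U: "unitary U" "\<And>i. \<bar>i\<bar> > M \<Longrightarrow> U (e i) = e i"
    using assms by (auto simp: U_Z_def)
  have "U x \<in> H0" if x: "x \<in> H0" for x
  proof -
    obtain N where N: "N \<ge> M" "x \<in> cspan (e ` {-N..N})"
      by (rule cspan_window_exists[OF x])
    have "U x \<in> cspan (e ` {-N..N})"
      by (rule local_unitary_window[OF basis U(1) _ N(2)]) (use N(1) in \<open>auto intro: U(2)\<close>)
    then show ?thesis
      by (rule subsetD[OF complex_vector.span_mono, rotated]) auto
  qed
  then show ?thesis
    using U(1) by (auto simp: localized_def)
qed

lemma shift_invariant_translate: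
  assumes "\<phi> \<in> invariant_states e W {shift e}" "x \<in> H0"
  shows "\<phi> (W (translate (int n) x)) = \<phi> (W x)"
proof (induction n)
  case 0
  show ?case by (simp add: translate_zero)
next
  case (Suc n)
  have "translate (int (Suc n)) x = shift e (translate (int n) x)"
    by (simp add: shift_eq_translate translate_translate add.commute)
  moreover have "\<phi> (W (shift e y)) = \<phi> (W y)" if "y \<in> H0" for y
    using assms(1) that invariant_states_iff[of "{shift e}" \<phi>] localized_shift by auto
  ultimately show ?case
    using Suc localized_H0[OF localized_translate assms(2)] by simp
qed

text \<open>\<open>star (W u) * W v\<close> is a phase times \<open>W (- u + v)\<close>. The map
  \<open>V\<close> sends \<open>- u + v\<close> to \<open>- u + v'\<close>, and it preserves the
  phase because it preserves inner products. Invariance on single Weyl elements thus lets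
  \<open>v\<close> be moved while \<open>u\<close> stays fixed.\<close>

lemma two_point_invariant:
  assumes \<omega>: "state_on B0 \<omega>" and inv: "\<And>x. x \<in> H0 \<Longrightarrow> \<omega> (W (V x)) = \<omega> (W x)"
    and V: "localized V" "V u = u" "V v = v'" and uv: "u \<in> H0" "v \<in> H0"
  shows "\<omega> (star (W u) * W v') = \<omega> (star (W u) * W v)"
proof -
  have lin: "clinear V" and iso: "cinner (V x) (V y) = cinner x y" for x y
    using V(1) by (auto simp: localized_def unitary_def)
  have v': "v' \<in> H0"
    using localized_H0[OF V(1) uv(2)] V(3) by simp
  then have mem: "- u + v \<in> H0" "- u + v' \<in> H0"
    using uv by (simp_all only: complex_vector.span_add complex_vector.span_neg)
  have "V (- u + v) = - u + v'"
    using V(2,3) by (simp add: clinear_diff[OF lin])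
  then have "\<omega> (W (- u + v')) = \<omega> (W (- u + v))"
    using inv[OF mem(1)] by simp
  moreover have "symp (- u) v' = symp (- u) v"
    using iso[of "- u" v] V by (simp add: symp_def clinear_uminus[OF lin])
  ultimately show ?thesis
    using mem by (simp add: W_star W_mult state_on_scaleC[OF \<omega>] W_in_B0 del: minus_add_distrib)
qed

text \<open>The averaging argument over disjoint windows. Domination enters through squares
  \<open>star a * a\<close>, and \<open>conj\<close> supplies copies of \<open>U\<close> acting in
  any translated window.\<close>

lemma invariant_if_below_invariant:
  assumes G: "G \<subseteq> U_Z e" and conj: "\<And>U n. U \<in> G \<Longrightarrow> (\<lambda>x. translate n (U (translate (- n) x))) \<in> G"
    and \<phi>: "\<phi> \<in> invariant_states e W {shift e}" and \<omega>: "\<omega> \<in> invariant_states e W G"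
    and t: "t > 0" and dom: "\<And>a. a \<in> B0 \<Longrightarrow> t * Re (\<phi> (star a * a)) \<le> Re (\<omega> (star a * a))"
    and U: "U \<in> G" and x: "x \<in> H0"
  shows "\<phi> (W (U x)) = \<phi> (W x)"
proof -
  have loc: "\<And>V. V \<in> G \<Longrightarrow> localized V"
    using G localized_U_Z by blast
  have st\<phi>: "state_on B0 \<phi>"
    using \<phi> by (simp add: invariant_states_def)
  have st\<omega>: "state_on B0 \<omega>" and inv: "\<And>V x. V \<in> G \<Longrightarrow> x \<in> H0 \<Longrightarrow> \<omega> (W (V x)) = \<omega> (W x)"
    using \<omega> by (auto simp: invariant_states_iff[OF loc])
  obtain M where M: "unitary U" "\<And>i. \<bar>i\<bar> > M \<Longrightarrow> U (e i) = e i"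
    using G U by (auto simp: U_Z_def)
  \<comment> \<open>One window for both the support of \<open>x\<close> and the sites moved by
    \<open>U\<close>.\<close>
  obtain N where N: "N \<ge> max 0 M" "x \<in> cspan (e ` {-N..N})"
    by (rule cspan_window_exists[OF x])
  have Ufix: "U (e i) = e i" if "\<bar>i\<bar> > N" for i
    using that N(1) by (intro M(2)) auto
  have Ux: "U x \<in> cspan (e ` {-N..N})"
    by (rule local_unitary_window[OF basis M(1) Ufix N(2)])
  have Ux0: "U x \<in> H0"
    by (rule localized_H0[OF loc[OF U] x])
  \<comment> \<open>The step \<open>2 * N + 1\<close> is the number of sites in
    \<open>{-N..N}\<close>, so different translates of the window are disjoint.\<close>
  define T where "T n = translate ((2 * N + 1) * int n)" for n
  have locT: "localized (T n)" for n
    unfolding T_def by (rule localized_translate)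
  have T0: "T n z \<in> H0" if "z \<in> H0" for n z
    by (rule localized_H0[OF locT that])
  have inv\<phi>: "\<phi> (W (T n z)) = \<phi> (W z)" if "z \<in> H0" for n z
    unfolding T_def using shift_invariant_translate[OF \<phi> that, of "nat (2 * N + 1) * n"] N(1) by simp
  have T_window: "T n z \<in> cspan (e ` {(2 * N + 1) * int n - N..(2 * N + 1) * int n + N})"
    if "z \<in> cspan (e ` {-N..N})" for n z
    by (rule clinear_cspan_mono[OF clinear_localized[OF locT] that])
      (auto simp: T_def translate_apply intro!: complex_vector.span_base)
  \<comment> \<open>The conjugate of \<open>U\<close> into window \<open>m\<close> moves
    \<open>T m x\<close> to \<open>T m (U x)\<close> and fixes every vector supported in window
    \<open>n\<close>. It is applied with \<open>z = x\<close> and with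
    \<open>z = U x\<close>.\<close>
  have cross: "\<omega> (star (W (T n z)) * W (T m (U x))) = \<omega> (star (W (T n z)) * W (T m x))"
    if "m \<noteq> n" and z: "z \<in> cspan (e ` {-N..N})" "z \<in> H0" for m n z
  proof (rule two_point_invariant[OF st\<omega>])
    let ?k = "(2 * N + 1) * int m"
    let ?V = "\<lambda>x. translate ?k (U (translate (- ?k) x))"
    have V: "?V \<in> G"
      by (rule conj[OF U])
    show "localized ?V"
      by (rule loc[OF V])
    show "\<omega> (W (?V x)) = \<omega> (W x)" if "x \<in> H0" for x
      by (rule inv[OF V that])
    show "?V (T m x) = T m (U x)"
      by (simp add: T_def translate_translate translate_zero)
    show "?V (T n z) = T n z"
    proof (rule clinear_eq_on_cspan[OF clinear_localized[OF loc[OF V]] _ _ T_window[OF z(1)]])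
      show "clinear (\<lambda>x :: 'h. x)"
        by (rule clinearI) simp_all
      show "?V v = v" if v: "v \<in> e ` {(2 * N + 1) * int n - N..(2 * N + 1) * int n + N}" for v
      proof -
        obtain i where i: "v = e i" "\<bar>i - (2 * N + 1) * int n\<bar> \<le> N"
          using v by auto
        \<comment> \<open>Distinct window centres are at least \<open>2 * N + 1\<close> apart, so a
          site within \<open>N\<close> of one centre is further than \<open>N\<close> from the other
          and \<open>U\<close>, moved there, fixes it.\<close>
        have "(2 * N + 1) * 1 \<le> (2 * N + 1) * \<bar>int n - int m\<bar>"
          using \<open>m \<noteq> n\<close> N(1) by (intro mult_left_mono) auto
        then have "2 * N + 1 \<le> \<bar>(2 * N + 1) * int n - ?k\<bar>"
          using N(1) by (simp add: abs_mult flip: right_diff_distrib)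
        then have "\<bar>i - ?k\<bar> > N"
          using i(2) by linarith
        then show ?thesis
          using Ufix[of "i - ?k"] by (simp add: i(1) translate_apply)
      qed
    qed
  qed (use T0 x z in auto)
  define b where "b n = W (T n (U x)) - W (T n x)" for n
  have bB: "b n \<in> B0" for n
    unfolding b_def by (intro cstar_subalgebra_diff[OF B0] W_in_B0 T0 x Ux0)
  have sbB: "star (b n) * b m \<in> B0" for n m
    using bB B0 by (intro cstar_subalgebraD(3,6))
  have off: "\<omega> (star (b n) * b m) = 0" if "m \<noteq> n" for m n
  proof -
    note mem = W_in_B0[OF T0[OF x]] W_in_B0[OF T0[OF Ux0]] cstar_subalgebraD(3,6)[OF B0]
      cstar_subalgebra_diff[OF B0]
    \<comment> \<open>In each bracket the two terms differ only by \<open>U x\<close> against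
      \<open>x\<close> in window \<open>m\<close>, so \<open>cross\<close> makes their values under
      \<open>\<omega>\<close> cancel.\<close>
    have "star (b n) * b m = (star (W (T n (U x))) * W (T m (U x)) - star (W (T n (U x))) * W (T m x))
        - (star (W (T n x)) * W (T m (U x)) - star (W (T n x)) * W (T m x))"
      by (simp add: b_def star_diff algebra_simps)
    then show ?thesis
      using cross[OF that Ux Ux0] cross[OF that N(2) x]
      by (simp only: state_on_diff[OF B0 st\<omega>] mem) simp
  qed
  have diag: "cmod (\<omega> (star (b n) * b n)) \<le> 4" for n
  proof -
    have "norm (b n) \<le> 2"
      using norm_triangle_ineq4[of "W (T n (U x))" "W (T n x)"] norm_W[of "T n (U x)"] norm_W[of "T n x"]
      unfolding b_def by linarith
    then have "(norm (b n))\<^sup>2 \<le> 2\<^sup>2"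
      by (intro power_mono) auto
    then show ?thesis
      using state_on_cmod_le_norm[OF B0 st\<omega> sbB, of n n] by (simp add: cstar_identity)
  qed
  let ?\<beta> = "\<phi> (W (U x)) - \<phi> (W x)"
  have bound: "real k * (cmod ?\<beta>)\<^sup>2 \<le> 4 / t" for k
  proof (cases "k = 0")
    case False
    define c where "c = (\<Sum>n<k. b n)"
    have cB: "c \<in> B0"
      unfolding c_def by (intro cstar_subalgebra_sum[OF B0] bB)
    have "star (\<Sum>n\<in>I. b n) = (\<Sum>n\<in>I. star (b n))" for I
      by (induction I rule: infinite_finite_induct) (simp_all add: star_add)
    then have "star c * c = (\<Sum>n<k. \<Sum>m<k. star (b n) * b m)"
      by (simp add: c_def sum_product)
    also have "\<omega> \<dots> = (\<Sum>n<k. \<Sum>m<k. \<omega> (star (b n) * b m))"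
      by (simp add: state_on_sum[OF B0 st\<omega>] sbB cstar_subalgebra_sum[OF B0])
    also have "\<dots> = (\<Sum>n<k. \<Sum>m<k. if m = n then \<omega> (star (b n) * b n) else 0)"
      by (intro sum.cong) (auto simp: off)
    also have "\<dots> = (\<Sum>n<k. \<omega> (star (b n) * b n))"
      by simp
    also have "cmod \<dots> \<le> (\<Sum>n<k. 4)"
      by (rule sum_norm_le) (rule diag)
    finally have upper: "Re (\<omega> (star c * c)) \<le> 4 * real k"
      using complex_Re_le_cmod[of "\<omega> (star c * c)"] by simp
    have "\<phi> c = (\<Sum>n<k. \<phi> (b n))"
      unfolding c_def by (rule state_on_sum[OF B0 st\<phi>]) (rule bB)
    also have "\<dots> = (\<Sum>n<k. ?\<beta>)"
      unfolding b_def
      by (simp add: state_on_diff[OF B0 st\<phi>] W_in_B0 T0 x Ux0 inv\<phi>)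
    finally have "\<phi> c = of_nat k * ?\<beta>"
      by simp
    then have "(real k * cmod ?\<beta>)\<^sup>2 \<le> Re (\<phi> (star c * c))"
      using state_on_Cauchy_Schwarz[OF B0 st\<phi> unit one_in_B0 cB] by (simp add: norm_mult)
    then have "t * (real k * cmod ?\<beta>)\<^sup>2 \<le> t * Re (\<phi> (star c * c))"
      using t by (intro mult_left_mono) auto
    also have "\<dots> \<le> 4 * real k"
      using dom[OF cB] upper by linarith
    \<comment> \<open>The left side is quadratic in \<open>k\<close> and the right side linear; one
      factor \<open>real k\<close> is isolated to be cancelled, which leaves a bound independent of
      \<open>k\<close>.\<close>
    finally have "real k * (t * (real k * (cmod ?\<beta>)\<^sup>2)) \<le> real k * 4"
      by (simp add: power2_eq_square algebra_simps)
    then show ?thesis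
      using False t by (simp add: field_simps)
  qed (use t in simp)
  have "(cmod ?\<beta>)\<^sup>2 \<le> 0"
  proof (rule ccontr)
    assume "\<not> (cmod ?\<beta>)\<^sup>2 \<le> 0"
    then obtain k where "4 / t < real k * (cmod ?\<beta>)\<^sup>2"
      using reals_Archimedean3[of "(cmod ?\<beta>)\<^sup>2"] by auto
    with bound[of k] show False by simp
  qed
  then show ?thesis by simp
qed

text \<open>Positivity of \<open>\<psi>\<close> shows that \<open>t *\<^sub>R \<phi>\<close> is
  dominated by the convex combination on squares, so the preceding lemma applies to
  \<open>\<phi>\<close>. Exchanging the two states and replacing \<open>t\<close> by
  \<open>1 - t\<close> treats \<open>\<psi>\<close>.\<close>

lemma invariant_states_face:
  assumes G: "G \<subseteq> U_Z e" and conj: "\<And>U n. U \<in> G \<Longrightarrow> (\<lambda>x. translate n (U (translate (- n) x))) \<in> G"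
    and sub: "invariant_states e W G \<subseteq> invariant_states e W {shift e}"
  shows "invariant_states e W G \<subset>\<^sub>F invariant_states e W {shift e}"
proof -
  have loc: "\<And>V. V \<in> G \<Longrightarrow> localized V"
    using G localized_U_Z by blast
  have left: "\<phi> \<in> invariant_states e W G"
    if \<phi>: "\<phi> \<in> invariant_states e W {shift e}" and \<psi>: "\<psi> \<in> invariant_states e W {shift e}"
      and t: "0 < t" "t < 1" and \<omega>: "t *\<^sub>R \<phi> + (1 - t) *\<^sub>R \<psi> \<in> invariant_states e W G" for \<phi> \<psi> and t :: real
  proof -
    have st: "state_on B0 \<phi>" "state_on B0 \<psi>"
      using \<phi> \<psi> by (auto simp: invariant_states_def)
    have dom: "t * Re (\<phi> (star a * a)) \<le> Re ((t *\<^sub>R \<phi> + (1 - t) *\<^sub>R \<psi>) (star a * a))" if "a \<in> B0" for a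
      using state_on_Re_nonneg[OF st(2) that] t by (simp add: scaleR_fun_def)
    have "\<phi> (W (U x)) = \<phi> (W x)" if "U \<in> G" "x \<in> H0" for U x
      by (rule invariant_if_below_invariant[OF G conj \<phi> \<omega> t(1) dom that])
    then show ?thesis
      using st(1) by (simp add: invariant_states_iff[OF loc])
  qed
  show ?thesis
    unfolding is_face_iff
  proof (intro conjI ballI allI impI)
    fix \<phi> \<psi> and t :: real
    assume *: "\<phi> \<in> invariant_states e W {shift e}" "\<psi> \<in> invariant_states e W {shift e}"
      "0 < t \<and> t < 1 \<and> t *\<^sub>R \<phi> + (1 - t) *\<^sub>R \<psi> \<in> invariant_states e W G"
    show "\<phi> \<in> invariant_states e W G"
      by (rule left[OF *(1,2), of t]) (use *(3) in simp_all)
    show "\<psi> \<in> invariant_states e W G"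
      by (rule left[OF *(2,1), of "1 - t"]) (use *(3) in \<open>simp_all add: add.commute\<close>)
  qed (rule convex_invariant_states sub)+
qed

section \<open>Inclusions between the groups and stability under conjugation by translates\<close>

lemma invariant_states_antimono: "G \<subseteq> G' \<Longrightarrow> invariant_states e W G' \<subseteq> invariant_states e W G"
  by (auto simp: invariant_states_def)

lemma O_Z_subset_U_Z: "O_Z e \<subseteq> U_Z e"
  by (auto simp: O_Z_def)

lemma P_Z_subset_O_Z: "P_Z e \<subseteq> O_Z e"
proof
  fix U assume "U \<in> P_Z e"
  then obtain s where s: "bij s" "finite {i. s i \<noteq> i}" and U: "U = basis_unitary e s"
    by (auto simp: P_Z_def)
  note app = basis_unitary_apply[OF basis s(1)]
  have "bdd_above (abs ` {i. s i \<noteq> i})"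
    using s(2) by simp
  then obtain M where M: "\<And>i. s i \<noteq> i \<Longrightarrow> \<bar>i\<bar> \<le> M"
    by (auto simp: bdd_above_def)
  \<comment> \<open>The maximum with 1 meets the requirement of a positive bound in
    \<open>U_Z\<close>.\<close>
  have "s i = i" if "\<bar>i\<bar> > max 1 M" for i
    using M[of i] that by (cases "s i = i") auto
  then have "\<forall>i. \<bar>i\<bar> > max 1 M \<longrightarrow> U (e i) = e i"
    by (simp add: U app)
  then have "\<exists>N>0. \<forall>i. \<bar>i\<bar> > N \<longrightarrow> U (e i) = e i"
    by (intro exI[of _ "max 1 M"]) simp
  moreover have "cinner (U (e i)) (e j) \<in> \<real>" for i j
    using basis by (simp add: U app orthonormal_basis_def)
  ultimately show "U \<in> O_Z e"
    using unitary_basis_unitary[OF basis s(1)] by (simp add: O_Z_def U_Z_def U)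
qed

lemma U_Z_conj:
  assumes "U \<in> U_Z e"
  shows "(\<lambda>x. translate n (U (translate (- n) x))) \<in> U_Z e"
proof -
  obtain N where N: "unitary U" "N > 0" "\<And>i. \<bar>i\<bar> > N \<Longrightarrow> U (e i) = e i"
    using assms by (auto simp: U_Z_def)
  \<comment> \<open>Conjugation displaces sites by \<open>n\<close>: from
    \<open>\<bar>i\<bar> > N + \<bar>n\<bar>\<close> follows
    \<open>\<bar>i - n\<bar> > N\<close>.\<close>
  have "translate n (U (translate (- n) (e i))) = e i" if "\<bar>i\<bar> > N + \<bar>n\<bar>" for i
    using N(3)[of "i - n"] that by (simp add: translate_apply)
  moreover have "N + \<bar>n\<bar> > 0"
    using N(2) by simp
  moreover have "unitary (\<lambda>x. translate n (U (translate (- n) x)))"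
    by (rule unitary_comp[OF unitary_translate unitary_comp[OF N(1) unitary_translate]])
  ultimately show ?thesis
    unfolding U_Z_def by (intro CollectI conjI exI[of _ "N + \<bar>n\<bar>"]) simp_all
qed

text \<open>The matrix entries of the conjugate are those of \<open>U\<close> with both indices
  shifted by \<open>n\<close>, hence real.\<close>

lemma O_Z_conj:
  assumes "U \<in> O_Z e"
  shows "(\<lambda>x. translate n (U (translate (- n) x))) \<in> O_Z e"
proof -
  have "cinner (translate n (U (translate (- n) (e i)))) (e j) \<in> \<real>" for i j
  proof -
    have "cinner (translate n (U (e (i - n)))) (translate n (e (j - n))) = cinner (U (e (i - n))) (e (j - n))"
      using unitary_translate[of n] by (simp add: unitary_def)
    then show ?thesis
      using assms by (simp add: translate_apply O_Z_def)
  qed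
  then show ?thesis
    using U_Z_conj assms by (simp add: O_Z_def)
qed

lemma P_Z_conj:
  assumes "U \<in> P_Z e"
  shows "(\<lambda>x. translate n (U (translate (- n) x))) \<in> P_Z e"
proof -
  obtain s where s: "bij s" "finite {i. s i \<noteq> i}" and U: "U = basis_unitary e s"
    using assms by (auto simp: P_Z_def)
  let ?s = "\<lambda>i. s (i - n) + n"
  have bij: "bij (\<lambda>i. s (i - n))"
    using bij_comp[OF bij_add_int[of "- n"] s(1)] by (simp add: comp_def)
  have "bij ?s"
    using bij_comp[OF bij bij_add_int[of n]] by (simp add: comp_def)
  moreover have "{i. ?s i \<noteq> i} \<subseteq> (\<lambda>i. i + n) ` {i. s i \<noteq> i}"
  proof
    show "i \<in> (\<lambda>i. i + n) ` {i. s i \<noteq> i}" if "i \<in> {i. ?s i \<noteq> i}" for i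
      using that by (intro image_eqI[where x = "i - n"]) auto
  qed
  then have "finite {i. ?s i \<noteq> i}"
    using s(2) finite_subset by blast
  moreover have "(\<lambda>x. translate n (U (translate (- n) x))) = basis_unitary e ?s"
    using basis_unitary_comp[OF basis s(1) bij_add_int, of "- n"] basis_unitary_comp[OF basis bij_add_int bij]
    by (simp add: U translate_def comp_def)
  ultimately show ?thesis
    unfolding P_Z_def by blast
qed

text \<open>On vectors supported in \<open>[-N, N]\<close> the shift agrees with a cyclic permutation of \<open>[-N, N + 1]\<close>.\<close>

lemma invariant_P_Z_subset_shift: "invariant_states e W (P_Z e) \<subseteq> invariant_states e W {shift e}"
proof
  fix \<omega> assume "\<omega> \<in> invariant_states e W (P_Z e)"
  moreover have loc: "localized U" if "U \<in> P_Z e" for U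
    using that P_Z_subset_O_Z O_Z_subset_U_Z localized_U_Z by blast
  ultimately have st: "state_on B0 \<omega>" and inv: "\<And>U x. U \<in> P_Z e \<Longrightarrow> x \<in> H0 \<Longrightarrow> \<omega> (W (U x)) = \<omega> (W x)"
    by (auto simp: invariant_states_iff)
  have "\<omega> (W (shift e x)) = \<omega> (W x)" if x: "x \<in> H0" for x
  proof -
    obtain N where N: "N \<ge> 0" "x \<in> cspan (e ` {-N..N})"
      by (rule cspan_window_exists[OF x])
    let ?s = "\<lambda>i. if -N \<le> i \<and> i \<le> N then i + 1 else if i = N + 1 then - N else i"
    let ?r = "\<lambda>i. if -N < i \<and> i \<le> N + 1 then i - 1 else if i = - N then N + 1 else i"
    have "0 \<le> 2 * N + 1"
      using N(1) by simp
    then have "?r (?s i) = i" "?s (?r i) = i" for i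
      using N(1) by auto
    then have bij: "bij ?s"
      by (intro o_bij[of ?r] ext) (simp_all only: comp_apply id_apply)
    moreover have "finite {i. ?s i \<noteq> i}"
      by (rule finite_subset[of _ "{-N..N + 1}"]) (use N(1) in auto)
    ultimately have P: "basis_unitary e ?s \<in> P_Z e"
      unfolding P_Z_def by blast
    have "shift e x = basis_unitary e ?s x"
    proof (rule clinear_eq_on_cspan[OF clinear_localized[OF localized_shift] clinear_localized[OF loc[OF P]] _ N(2)])
      show "shift e v = basis_unitary e ?s v" if "v \<in> e ` {-N..N}" for v
        using that by (auto simp: basis_unitary_apply[OF basis bij] shift_eq_translate translate_apply)
    qed
    then show ?thesis
      using inv[OF P x] by simp
  qed
  then show "\<omega> \<in> invariant_states e W {shift e}"
    using st invariant_states_iff[of "{shift e}" \<omega>] localized_shift by auto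
qed

end

theorem proposition3p5:
  fixes e :: "int \<Rightarrow> 'h::complex_hilbert" and W :: "'h \<Rightarrow> 'a::cstar_algebra"
  assumes "orthonormal_basis e" and "ccr_algebra W"
  shows "invariant_states e W (U_Z e) \<subset>\<^sub>F invariant_states e W (O_Z e) \<and>
         invariant_states e W (O_Z e) \<subset>\<^sub>F invariant_states e W (P_Z e) \<and>
         invariant_states e W (P_Z e) \<subset>\<^sub>F invariant_states e W {shift e}"
proof -
  interpret ccr_basis W e
    using assms by unfold_locales
  let ?S = "invariant_states e W"
  \<comment> \<open>The first two inclusions reverse inclusions of groups. The shift moves
    infinitely many sites, so the third rests on the cyclic permutations instead.\<close>
  have UO: "?S (U_Z e) \<subseteq> ?S (O_Z e)" and OP: "?S (O_Z e) \<subseteq> ?S (P_Z e)" and PZ: "?S (P_Z e) \<subseteq> ?S {shift e}"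
    by (rule invariant_states_antimono O_Z_subset_U_Z P_Z_subset_O_Z invariant_P_Z_subset_shift)+
  have U: "?S (U_Z e) \<subset>\<^sub>F ?S {shift e}"
    by (rule invariant_states_face[OF _ U_Z_conj]) (use UO OP PZ in auto)
  have O: "?S (O_Z e) \<subset>\<^sub>F ?S {shift e}"
    by (rule invariant_states_face[OF O_Z_subset_U_Z O_Z_conj]) (use OP PZ in auto)
  have P: "?S (P_Z e) \<subset>\<^sub>F ?S {shift e}"
    by (rule invariant_states_face[OF _ P_Z_conj PZ]) (use P_Z_subset_O_Z O_Z_subset_U_Z in auto)
  \<comment> \<open>A face of the shift-invariant states is also a face of every intermediate set of
    the chain that contains it.\<close>
  show ?thesis
    using U O P face_of_subset[OF _ UO order_trans[OF OP PZ]] face_of_subset[OF _ OP PZ]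
      convex_invariant_states
    by (simp add: is_face_def)
qed

end
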